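(* Fix $r\in(0,1)$. Let $\rho$ be the autocovariance function of the weakly stationary solution $X$ of the ARCH($\infty$) equations with data $a$, $b$, $\xi$. Suppose that $\Omega<1$ and $\lambda_1\sum_{j=1}^\infty b(j)r^{-j}<1$. If $b\in\mathcal{W}(r)$, then $\rho\in\mathcal{W}(r)$ (i.e. $(\rho(n))_{n\ge 0}\in\mathcal{W}(r)$). Moreover, $$\lim_{n\to\infty}\frac{\rho(n)}{b(n)}=\frac{\mathbb{E}[\nu(0)^2]}{1-\lambda_1\sum_{j=1}^\infty b(j)r^{j}}\cdot\frac{\lambda_1}{\big(1-\lambda_1\sum_{j=1}^\infty b(j)r^{-j}\big)^2}.$$
   Context: ARCH($\infty$) setting. Let $\xi=\{\xi(k)\}_{k\in\mathbb{Z}}$ be i.i.d. non-negative random variables, $a\ge 0$ a constant, and $b=\{b(j)\}_{j\ge1}$ a real sequence with $b(j)\ge 0$. A random sequence $X=\{X(k)\}_{k\in\mathbb{Z}}$ satisfies the ARCH($\infty$) equations if $X(k)=\varsigma(k)\xi(k)$, $\varsigma(k)=a+\sum_{j=1}^\infty b(j)X(k-j)$ for all $k\in\mathbb{Z}$. Put $\lambda_1=\mathbb{E}[\xi(0)]$, $\lambda_2=\mathbb{E}[\xi(0)^2]$, $\sigma^2=\mathrm{Var}[\xi(0)]=\lambda_2-\lambda_1^2$, $B=\sum_{j=1}^\infty b(j)$, $\nu(k)=X(k)-\lambda_1\varsigma(k)$. Standing assumptions: $\lambda_1\in(0,\infty)$, $a>0$, $\sigma\in(0,\infty)$, and $b$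 is not identically zero. The sequence $z$ is defined by $z(0)=1$, $z(n)=\lambda_1\sum_{j=0}^{n-1}b(n-j)z(j)$ for $n\ge 1$ (when $\lambda_1B<1$, these are the power series coefficients of $1/(1-\lambda_1\sum_{j\ge1}b(j)\lambda^j)$ on $|\lambda|\le 1$), and $\Omega=\frac{\sigma}{\lambda_1}\big(\sum_{j=1}^\infty z(j)^2\big)^{1/2}$. A process is (weakly) stationary if it has constant finite mean and $\mathrm{Cov}[X(n),X(n+k)]$ depends only on $k$; $\rho(k)=\mathrm{Cov}[X(n),X(n+k)]$, $k\in\mathbb{Z}$, is its autocovariance function. Known fact (recalled by the paper): if $\lambda_1B<1$ and $\Omega<1$, there is a unique weakly stationary solution $X$ of the ARCH($\infty$) equations; it satisfies $\rho(k)=\mathbb{E}[\nu(0)^2]\sum_{j=0}^\infty z(j)z(j+|k|)$ for $k\in\mathbb{Z}$, with $\mathbb{E}[\nu(0)^2]=\big(\frac{a\sigma}{1-\lambda_1B}\big)^2\frac{1}{1-\Omega^2}$. Weight class. For finite $r>0$, a real sequence $\gamma=\{\gamma(n)\}_{n\ge0}$ is in $\mathcal{W}(r)$ if $\gamma(n)>0$ for all $n\ge 0$, $\lim_{n\to\infty}\gamma(n-1)/\gamma(n)=1/r$, $\sum_{i=0}^\infty\gamma(i)r^{-i}<\infty$, and $\lim_{m\to\infty}\big(\limsup_{n\to\infty}\frac1{\gamma(n)}\sum_{i=m}^{n-m}\gamma(n-i)\gamma(i)\big)=0$. For the sequence $b$, indexed by $j\ge1$, membership in $\mathcal{W}(r)$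 means that $b(n)>0$ for all $n\ge1$ and that the sequence obtained by assigning any positive value to $b(0)$ lies in $\mathcal{W}(r)$ (this does not depend on the value). *)

theory Defs
  imports "HOL-Probability.Probability"
begin

text \<open>
  A sequence \<open>b\<close> indexed by \<open>j \<ge> 1\<close> is a function on \<open>nat\<close> whose value at \<open>0\<close> is never used;
  sums over \<open>j \<ge> 1\<close> are written with the index \<open>Suc j\<close>.
\<close>

definition iid :: "'w measure \<Rightarrow> (int \<Rightarrow> 'w \<Rightarrow> real) \<Rightarrow> bool" where
  "iid M \<xi> \<longleftrightarrow> prob_space.indep_vars M (\<lambda>_. borel) \<xi> UNIV \<and>
     (\<forall>k. distr M borel (\<xi> k) = distr M borel (\<xi> 0))"

definition volatility ::
    "real \<Rightarrow> (nat \<Rightarrow> real) \<Rightarrow> (int \<Rightarrow> 'w \<Rightarrow> real) \<Rightarrow> int \<Rightarrow> 'w \<Rightarrow> real" where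
  "volatility a b X k \<omega> = a + (\<Sum>j. b (Suc j) * X (k - int (Suc j)) \<omega>)"

definition arch_solution ::
    "'w measure \<Rightarrow> (int \<Rightarrow> 'w \<Rightarrow> real) \<Rightarrow> real \<Rightarrow> (nat \<Rightarrow> real) \<Rightarrow> (int \<Rightarrow> 'w \<Rightarrow> real) \<Rightarrow> bool" where
  "arch_solution M \<xi> a b X \<longleftrightarrow>
     (\<forall>k. X k \<in> borel_measurable M) \<and>
     (\<forall>k. AE \<omega> in M. summable (\<lambda>j. b (Suc j) * X (k - int (Suc j)) \<omega>) \<and>
        X k \<omega> = volatility a b X k \<omega> * \<xi> k \<omega>)"

definition covariance :: "'w measure \<Rightarrow> ('w \<Rightarrow> real) \<Rightarrow> ('w \<Rightarrow> real) \<Rightarrow> real" where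
  "covariance M Y Z =
     prob_space.expectation M (\<lambda>\<omega>.
       (Y \<omega> - prob_space.expectation M Y) * (Z \<omega> - prob_space.expectation M Z))"

text \<open>
  Square integrability is what makes the covariances (for lag \<open>0\<close>, the variance) well defined and
  finite; the Bochner integral of a non-integrable function would be \<open>0\<close>.
\<close>

definition weakly_stationary :: "'w measure \<Rightarrow> (int \<Rightarrow> 'w \<Rightarrow> real) \<Rightarrow> bool" where
  "weakly_stationary M X \<longleftrightarrow>
     (\<forall>n. integrable M (X n) \<and> integrable M (\<lambda>\<omega>. (X n \<omega>)\<^sup>2)) \<and>
     (\<forall>n m. prob_space.expectation M (X n) = prob_space.expectation M (X m)) \<and>
     (\<forall>k n m. covariance M (X n) (X (n + k)) = covariance M (X m) (X (m + k)))"

text \<open>For weakly stationary processes the base point \<open>0\<close> is immaterial.\<close>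

definition autocovariance :: "'w measure \<Rightarrow> (int \<Rightarrow> 'w \<Rightarrow> real) \<Rightarrow> int \<Rightarrow> real" where
  "autocovariance M X k = covariance M (X 0) (X k)"

fun arch_z :: "real \<Rightarrow> (nat \<Rightarrow> real) \<Rightarrow> nat \<Rightarrow> real" where
  "arch_z l b 0 = 1"
| "arch_z l b (Suc n) = l * (\<Sum>j = 0..n. b (Suc n - j) * arch_z l b j)"

text \<open>
  In \<open>arch_Omega\<close>, \<open>l\<close> and \<open>s\<close> are the mean and the standard deviation of the noise. The squares
  are summable whenever \<open>b\<close> is non-negative, \<open>l > 0\<close> and \<open>l * (\<Sum>j. b (Suc j)) < 1\<close>, since then
  \<open>arch_z l b\<close> itself is non-negative and summable.
\<close>

definition arch_Omega :: "real \<Rightarrow> real \<Rightarrow> (nat \<Rightarrow> real) \<Rightarrow> real" where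
  "arch_Omega l s b = s / l * sqrt (\<Sum>j. (arch_z l b (Suc j))\<^sup>2)"

text \<open>
  The upper limit is taken in \<open>ereal\<close> because it may be infinite. For \<open>n < 2 * m\<close> with \<open>m \<ge> 1\<close>
  the truncated subtraction still yields an empty range of summation.
\<close>

definition weight_class :: "real \<Rightarrow> (nat \<Rightarrow> real) set" where
  "weight_class r = {\<gamma>.
     (\<forall>n. \<gamma> n > 0) \<and>
     (\<lambda>n. \<gamma> (n - 1) / \<gamma> n) \<longlonglongrightarrow> 1 / r \<and>
     summable (\<lambda>i. \<gamma> i / r ^ i) \<and>
     (\<lambda>m. limsup (\<lambda>n. ereal (1 / \<gamma> n * (\<Sum>i = m..n - m. \<gamma> (n - i) * \<gamma> i)))) \<longlonglongrightarrow> 0}"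

definition weight_class1 :: "real \<Rightarrow> (nat \<Rightarrow> real) set" where
  "weight_class1 r = {b. (\<forall>n\<ge>1. b n > 0) \<and> (\<forall>c>0. b(0 := c) \<in> weight_class r)}"

end

theory Submission imports Defs begin

text \<open>
  Write \<open>z\<close> for \<open>arch_z \<lambda>\<^sub>1 b\<close>. The theorem splits into a probabilistic identity,
  \<open>\<rho> n = E[\<nu>(0)\<^sup>2] * (\<Sum>j. z j * z (n + j))\<close> (\<open>autocovariance_sums\<close>), and the asymptotics of
  the deterministic sequence on its right-hand side (\<open>arch_z_autocorrelation_asymp\<close>).

  \<^bold>\<open>The identity.\<close> A solution is a pathwise solution of the equations at all times, and nothing in
  this says that \<open>X(k)\<close> is a function of the noise up to time \<open>k\<close>; causality has to be proved.
  Substituting the equation into itself down to level \<open>k - N\<close> writes \<open>X(k)\<close> as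
  \<open>a * (\<Sum>i<N. \<xi>(k - i) * S(i))\<close> plus a remainder which involves \<open>X\<close> only at or below that
  level (\<open>renewal_expansion\<close>); \<open>S(i)\<close> sums the products of weights and noise over all chains of times
  from \<open>k\<close> to \<open>k - i\<close>. Centring the noise decomposes \<open>\<xi>(k - i) * S(i)\<close> orthogonally with
  coefficients from \<open>z\<close> (\<open>renewal_decomposition\<close>), so that \<open>E[S(i)\<^sup>2]\<close> satisfies a renewal
  equation with total mass \<open>\<Omega>\<^sup>2 < 1\<close>, and hence is summable. By the Cauchy-Schwarz inequality the
  remainder tends to \<open>0\<close> in mean, and \<open>X(k)\<close> is almost surely a series in the noise up to time
  \<open>k\<close> (\<open>solution_AE_causal\<close>). Therefore \<open>\<nu>(k)\<close>, which is \<open>\<xi>(k) - \<lambda>\<^sub>1\<close> times the volatility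
  at time \<open>k\<close>, is orthogonal to everything before time \<open>k\<close>. It follows that \<open>E[\<nu>(0) X(n)]\<close> obeys
  the recursion which defines \<open>z\<close>, and that
  \<open>\<rho>(n) = E[\<nu>(0) X(n)] + \<lambda>\<^sub>1 * (\<Sum>j\<ge>1. b(j) * \<rho>(n + j))\<close>. This is again an equation of the type
  that \<open>renewal_expansion\<close> unfolds, now with the constant \<open>\<lambda>\<^sub>1\<close> as noise, and its bounded
  solution is the claimed series.

  \<^bold>\<open>The asymptotics.\<close> Put \<open>q = \<lambda>\<^sub>1 * (\<Sum>j\<ge>1. b(j) / r^j) < 1\<close>. For a weight \<open>b\<close> the convolution
  \<open>z(n) = \<lambda>\<^sub>1 * (\<Sum>j<n. b(n - j) * z(j))\<close> is dominated by its two ends: the terms with small \<open>j\<close>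
  contribute \<open>\<lambda>\<^sub>1 * b(n) * (\<Sum>j. z(j) / r^j) = b(n) * \<lambda>\<^sub>1 / (1 - q)\<close>, and those with \<open>j\<close> close to
  \<open>n\<close> contribute \<open>q * z(n)\<close>. The limit \<open>A\<close> of \<open>z(n) / b(n)\<close> thus solves
  \<open>A = \<lambda>\<^sub>1 / (1 - q) + q * A\<close>, and as \<open>q < 1\<close> the same splitting is a contraction which forces
  convergence to it (\<open>arch_z_weight_class1\<close>). Since \<open>b(n + j) / b(n) \<longlonglongrightarrow> r^j\<close>, dominated
  convergence gives \<open>(\<Sum>j. z j * z (n + j)) / b n \<longlonglongrightarrow> A * (\<Sum>j. z j * r^j)\<close>, and the last sum is
  a value of the generating function of \<open>z\<close>. Finally, a positive sequence asymptotically
  proportional to a member of a weight class is in that class (\<open>weight_class_asymp\<close>).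
\<close>

section \<open>Weight classes\<close>

lemma weight_class_convolution_iff:
  assumes "\<And>n. \<gamma> n > 0"
  shows "((\<lambda>m. limsup (\<lambda>n. ereal (1 / \<gamma> n * (\<Sum>i = m..n - m. \<gamma> (n - i) * \<gamma> i)))) \<longlonglongrightarrow> 0) \<longleftrightarrow>
    (\<forall>e>0. \<forall>\<^sub>F m in sequentially. \<forall>\<^sub>F n in sequentially.
       (\<Sum>i = m..n - m. \<gamma> (n - i) * \<gamma> i) \<le> e * \<gamma> n)"
    (is "(\<lambda>m. limsup (?q m)) \<longlonglongrightarrow> 0 \<longleftrightarrow> ?R")
proof
  have q_le: "?q m n \<le> ereal e \<longleftrightarrow> (\<Sum>i = m..n - m. \<gamma> (n - i) * \<gamma> i) \<le> e * \<gamma> n" for m n e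
    using assms[of n] by (simp add: field_simps)
  {
    assume L: "(\<lambda>m. limsup (?q m)) \<longlonglongrightarrow> 0"
    show ?R
    proof (intro allI impI)
      fix e :: real assume "e > 0"
      with L have "\<forall>\<^sub>F m in sequentially. limsup (?q m) < ereal e"
        by (intro order_tendstoD) auto
      then show "\<forall>\<^sub>F m in sequentially. \<forall>\<^sub>F n in sequentially.
          (\<Sum>i = m..n - m. \<gamma> (n - i) * \<gamma> i) \<le> e * \<gamma> n"
      proof eventually_elim
        case (elim m)
        then have "\<forall>\<^sub>F n in sequentially. ?q m n < ereal e" by (rule Limsup_lessD)
        then show ?case by eventually_elim (simp only: q_le [symmetric] less_imp_le)
      qed
    qed
  next
    assume R: ?R
    have q_nonneg: "0 \<le> ?q m n" for m n
      using assms by (simp add: sum_nonneg less_imp_le)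
    have ge0: "0 \<le> limsup (?q m)" for m
      by (intro le_Limsup always_eventually allI q_nonneg) simp
    show "(\<lambda>m. limsup (?q m)) \<longlonglongrightarrow> 0"
    proof (rule order_tendstoI)
      fix y :: ereal assume "y < 0"
      then show "\<forall>\<^sub>F m in sequentially. y < limsup (?q m)"
        using ge0 by (intro always_eventually allI) (rule less_le_trans)
    next
      fix y :: ereal assume "0 < y"
      then obtain e where e: "0 < ereal e" "ereal e < y" using ereal_dense2 by blast
      with R have "\<forall>\<^sub>F m in sequentially. \<forall>\<^sub>F n in sequentially.
         (\<Sum>i = m..n - m. \<gamma> (n - i) * \<gamma> i) \<le> e * \<gamma> n" by auto
      then show "\<forall>\<^sub>F m in sequentially. limsup (?q m) < y"
      proof eventually_elim
        case (elim m)
        then have "\<forall>\<^sub>F n in sequentially. ?q m n \<le> ereal e"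
          by eventually_elim (simp only: q_le)
        then have "limsup (?q m) \<le> ereal e" by (rule Limsup_bounded)
        with e show ?case by (rule_tac le_less_trans)
      qed
    qed
  }
qed

text \<open>
  Every condition in the definition of a weight class compares values of the same sequence, so it
  survives a change of the sequence by factors that converge to a positive limit. For the
  convolution condition, which is quadratic over linear, two-sided bounds by multiples suffice.
\<close>

lemma weight_class_asymp:
  assumes \<gamma>: "\<gamma> \<in> weight_class r" and pos: "\<And>n. \<delta> n > 0"
    and lim: "(\<lambda>n. \<delta> n / \<gamma> n) \<longlonglongrightarrow> L" and "L > 0" and "r > 0"
  shows "\<delta> \<in> weight_class r"
proof -
  have gpos: "\<gamma> n > 0" for n using \<gamma> by (simp add: weight_class_def)
  have ratio: "(\<lambda>n. \<gamma> (n - 1) / \<gamma> n) \<longlonglongrightarrow> 1 / r" and sm: "summable (\<lambda>i. \<gamma> i / r ^ i)"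
    using \<gamma> by (simp_all add: weight_class_def)
  have "Bseq (\<lambda>n. \<delta> n / \<gamma> n)"
    using lim by (intro convergent_imp_Bseq) (auto simp: convergent_def)
  then obtain C where "C > 0" and C': "\<And>n. norm (\<delta> n / \<gamma> n) \<le> C" by (auto elim: BseqE)
  then have C: "\<delta> n \<le> C * \<gamma> n" for n
  proof -
    have "\<delta> n / \<gamma> n \<le> C" using C'[of n] by (simp only: real_norm_def abs_le_D1)
    then show ?thesis using gpos[of n] by (simp add: pos_divide_le_eq)
  qed
  have c: "\<forall>\<^sub>F n in sequentially. L / 2 * \<gamma> n \<le> \<delta> n"
  proof -
    have "\<forall>\<^sub>F n in sequentially. L / 2 < \<delta> n / \<gamma> n"
      using lim \<open>L > 0\<close> by (intro order_tendstoD) auto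
    then show ?thesis
    proof eventually_elim
      case (elim n)
      then show ?case using gpos[of n] by (simp add: field_simps)
    qed
  qed
  have "(\<lambda>n. \<delta> (n - 1) / \<delta> n) \<longlonglongrightarrow> 1 / r"
  proof -
    have "LIM n sequentially. n - 1 :> sequentially"
      by (simp add: filterlim_minus_const_nat_at_top)
    then have "(\<lambda>n. \<delta> (n - 1) / \<gamma> (n - 1)) \<longlonglongrightarrow> L"
      by (rule filterlim_compose[OF lim])
    from tendsto_divide[OF tendsto_mult[OF this ratio] lim] \<open>L > 0\<close>
    have "(\<lambda>n. \<delta> (n - 1) / \<gamma> (n - 1) * (\<gamma> (n - 1) / \<gamma> n) / (\<delta> n / \<gamma> n)) \<longlonglongrightarrow> L * (1 / r) / L"
      by simp
    moreover have "\<delta> (n - 1) / \<gamma> (n - 1) * (\<gamma> (n - 1) / \<gamma> n) / (\<delta> n / \<gamma> n) = \<delta> (n - 1) / \<delta> n" for n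
      using gpos[of n] gpos[of "n - 1"] pos[of n] by (simp add: field_simps)
    ultimately show ?thesis using \<open>L > 0\<close>
      by (simp only: nonzero_mult_div_cancel_left[OF less_imp_neq[OF \<open>L > 0\<close>, symmetric]])
  qed
  moreover have "summable (\<lambda>i. \<delta> i / r ^ i)"
  proof (rule summable_comparison_test')
    show "summable (\<lambda>i. C * (\<gamma> i / r ^ i))" using sm by (rule summable_mult)
    show "norm (\<delta> i / r ^ i) \<le> C * (\<gamma> i / r ^ i)" for i
      using C[of i] pos[of i] \<open>r > 0\<close> by (simp add: field_simps)
  qed
  moreover have "(\<lambda>m. limsup (\<lambda>n. ereal (1 / \<delta> n * (\<Sum>i = m..n - m. \<delta> (n - i) * \<delta> i)))) \<longlonglongrightarrow> 0"
    unfolding weight_class_convolution_iff[of \<delta>, OF pos]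
  proof (intro allI impI)
    fix e :: real assume "e > 0"
    \<comment> \<open>Chosen so that \<open>C\<^sup>2 * e'\<close> is \<open>e\<close> times the constant of the lower bound.\<close>
    define e' where "e' = e * L / 2 / C^2"
    have "e' > 0" using \<open>e > 0\<close> \<open>L > 0\<close> \<open>C > 0\<close> by (simp add: e'_def)
    have "\<forall>\<^sub>F m in sequentially. \<forall>\<^sub>F n in sequentially.
        (\<Sum>i = m..n - m. \<gamma> (n - i) * \<gamma> i) \<le> e' * \<gamma> n"
      using \<gamma> \<open>e' > 0\<close> weight_class_convolution_iff[of \<gamma>, OF gpos] by (simp add: weight_class_def)
    then show "\<forall>\<^sub>F m in sequentially. \<forall>\<^sub>F n in sequentially.
        (\<Sum>i = m..n - m. \<delta> (n - i) * \<delta> i) \<le> e * \<delta> n"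
    proof eventually_elim
      case (elim m)
      from elim c show ?case
      proof eventually_elim
        case (elim n)
        have "(\<Sum>i = m..n - m. \<delta> (n - i) * \<delta> i) \<le> (\<Sum>i = m..n - m. (C * \<gamma> (n - i)) * (C * \<gamma> i))"
          using C pos gpos \<open>C > 0\<close> by (intro sum_mono mult_mono) (auto simp: less_imp_le)
        also have "\<dots> = C^2 * (\<Sum>i = m..n - m. \<gamma> (n - i) * \<gamma> i)"
          by (simp add: sum_distrib_left power2_eq_square algebra_simps)
        also have "\<dots> \<le> C^2 * (e' * \<gamma> n)" using elim by (intro mult_left_mono) auto
        also have "\<dots> = e * (L / 2 * \<gamma> n)" using \<open>C > 0\<close> by (simp add: e'_def)
        also have "\<dots> \<le> e * \<delta> n" using elim \<open>e > 0\<close> by (intro mult_left_mono) auto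
        finally show ?case .
      qed
    qed
  qed
  ultimately show ?thesis using pos by (simp add: weight_class_def)
qed

text \<open>
  These are inherited from \<open>b(0 := 1)\<close>: shifted indices are eventually positive, and for \<open>m \<ge> 1\<close>
  the middle part of the convolution avoids the value at \<open>0\<close>.
\<close>

lemma weight_class1_D:
  assumes b: "b \<in> weight_class1 r"
  shows weight_class1_pos: "n \<ge> 1 \<Longrightarrow> b n > 0"
    and weight_class1_ratio: "(\<lambda>n. b (n - i) / b n) \<longlonglongrightarrow> 1 / r ^ i"
    and weight_class1_mid: "e > 0 \<Longrightarrow> \<forall>\<^sub>F m in sequentially. \<forall>\<^sub>F n in sequentially.
       (\<Sum>i = m..n - m. b (n - i) * b i) \<le> e * b n"
proof -
  show pos: "b n > 0" if "n \<ge> 1" for n using b that by (simp add: weight_class1_def)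
  define \<gamma> where "\<gamma> = b(0 := 1)"
  have \<gamma>: "\<gamma> \<in> weight_class r" using b by (simp add: weight_class1_def \<gamma>_def)
  then have gpos: "\<gamma> n > 0" for n by (simp add: weight_class_def)
  have gb: "\<gamma> n = b n" if "n \<ge> 1" for n using that by (simp add: \<gamma>_def)
  have ratio: "(\<lambda>n. \<gamma> (n - 1) / \<gamma> n) \<longlonglongrightarrow> 1 / r" using \<gamma> by (simp add: weight_class_def)
  have "(\<lambda>n. \<gamma> (n - i) / \<gamma> n) \<longlonglongrightarrow> (1 / r) ^ i"
  proof (induction i)
    case 0
    have "\<gamma> n \<noteq> 0" for n using gpos[of n] by simp
    then show ?case by simp
  next
    case (Suc i)
    have "(\<lambda>n. \<gamma> (n - i - 1) / \<gamma> (n - i)) \<longlonglongrightarrow> 1 / r"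
      by (intro filterlim_compose[OF ratio] filterlim_minus_const_nat_at_top)
    then have "(\<lambda>n. \<gamma> (n - i - 1) / \<gamma> (n - i) * (\<gamma> (n - i) / \<gamma> n)) \<longlonglongrightarrow> 1 / r * (1 / r) ^ i"
      by (intro tendsto_mult Suc)
    moreover have "\<gamma> (n - i - 1) / \<gamma> (n - i) * (\<gamma> (n - i) / \<gamma> n) = \<gamma> (n - Suc i) / \<gamma> n" for n
      using gpos[of n] gpos[of "n - i"] by simp
    ultimately show ?case by (simp only: power_Suc)
  qed
  moreover have "\<forall>\<^sub>F n in sequentially. \<gamma> (n - i) / \<gamma> n = b (n - i) / b n"
    using eventually_gt_at_top[of i] by eventually_elim (simp add: gb)
  ultimately have "(\<lambda>n. b (n - i) / b n) \<longlonglongrightarrow> (1 / r) ^ i"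
    by (rule Lim_transform_eventually)
  then show "(\<lambda>n. b (n - i) / b n) \<longlonglongrightarrow> 1 / r ^ i"
    by (simp add: power_one_over)
  assume "e > 0"
  then have "\<forall>\<^sub>F m in sequentially. \<forall>\<^sub>F n in sequentially.
      (\<Sum>i = m..n - m. \<gamma> (n - i) * \<gamma> i) \<le> e * \<gamma> n"
    using \<gamma> weight_class_convolution_iff[of \<gamma>, OF gpos] by (simp add: weight_class_def)
  with eventually_ge_at_top[of 1]
  show "\<forall>\<^sub>F m in sequentially. \<forall>\<^sub>F n in sequentially.
       (\<Sum>i = m..n - m. b (n - i) * b i) \<le> e * b n"
  proof eventually_elim
    case (elim m)
    from elim(2) eventually_ge_at_top[of 1] show ?case
    proof eventually_elim
      case (elim n)
      have "(\<Sum>i = m..n - m. \<gamma> (n - i) * \<gamma> i) = (\<Sum>i = m..n - m. b (n - i) * b i)"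
        using \<open>1 \<le> m\<close> by (intro sum.cong) (auto simp: gb)
      with elim show ?case by (simp add: gb)
    qed
  qed
qed

section \<open>The generating function of the renewal sequence\<close>

lemma arch_z_nonneg:
  assumes "l \<ge> 0" and "\<And>j. j \<ge> 1 \<Longrightarrow> b j \<ge> 0"
  shows "arch_z l b n \<ge> 0"
proof (induction n rule: less_induct)
  case (less n)
  then show ?case using assms
    by (cases n) (auto intro!: mult_nonneg_nonneg sum_nonneg)
qed

lemma arch_z_pos:
  assumes "l > 0" and b: "\<And>j. j \<ge> 1 \<Longrightarrow> b j > 0"
  shows "arch_z l b n > 0"
proof (cases n)
  case (Suc m)
  have nn: "arch_z l b j \<ge> 0" for j
    using assms by (intro arch_z_nonneg) (auto intro: less_imp_le)
  have "0 < b (Suc m - 0) * arch_z l b 0" using b[of "Suc m"] by simp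
  also have "\<dots> \<le> (\<Sum>j = 0..m. b (Suc m - j) * arch_z l b j)"
    using nn b by (intro member_le_sum mult_nonneg_nonneg) (auto intro: less_imp_le)
  finally show ?thesis using Suc \<open>l > 0\<close> by simp
qed simp

text \<open>
  Geometric reweighting of \<open>b\<close> reweights \<open>z\<close> in the same way. This reduces the generating function
  of \<open>z\<close> at any point to its value at \<open>1\<close>.
\<close>

lemma arch_z_rescale: "arch_z l (\<lambda>j. b j * t ^ j) n = arch_z l b n * t ^ n"
proof (induction n rule: less_induct)
  case (less n)
  show ?case
  proof (cases n)
    case (Suc k)
    have "b (Suc k - j) * t ^ (Suc k - j) * arch_z l (\<lambda>j. b j * t ^ j) j
        = b (Suc k - j) * arch_z l b j * t ^ Suc k" if "j \<le> k" for j
    proof -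
      have "t ^ (Suc k - j) * t ^ j = t ^ Suc k" using that by (simp flip: power_add)
      then show ?thesis using less[of j] that Suc by (simp add: mult_ac)
    qed
    then have "(\<Sum>j = 0..k. b (Suc k - j) * t ^ (Suc k - j) * arch_z l (\<lambda>j. b j * t ^ j) j)
        = (\<Sum>j = 0..k. b (Suc k - j) * arch_z l b j * t ^ Suc k)"
      by (intro sum.cong) auto
    then show ?thesis using Suc
      by (simp add: sum_distrib_right mult.assoc del: power_Suc)
  qed simp
qed

text \<open>
  The formula is the Cauchy product of \<open>z\<close> and \<open>b\<close>, but that presupposes convergence. The partial
  sums \<open>s(N)\<close> of \<open>z\<close> satisfy \<open>s(N + 1) \<le> 1 + l * B * s(N)\<close>, where \<open>B\<close> is the sum of \<open>b\<close>; as
  \<open>l * B < 1\<close>, this bounds them.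
\<close>

lemma arch_z_sums:
  assumes "l \<ge> 0" and b: "\<And>j. j \<ge> 1 \<Longrightarrow> b j \<ge> 0"
    and sm: "summable (\<lambda>j. b (Suc j))" and less1: "l * (\<Sum>j. b (Suc j)) < 1"
  shows "summable (arch_z l b)" and "(\<Sum>n. arch_z l b n) = 1 / (1 - l * (\<Sum>j. b (Suc j)))"
proof -
  define z where "z = arch_z l b"
  define B where "B = (\<Sum>j. b (Suc j))"
  have z0: "z n \<ge> 0" for n unfolding z_def using assms by (intro arch_z_nonneg) auto
  have zrec: "z (Suc n) = l * (\<Sum>j\<le>n. z j * b (Suc (n - j)))" for n
  proof -
    have "(\<Sum>j = 0..n. b (Suc n - j) * z j) = (\<Sum>j\<le>n. z j * b (Suc (n - j)))"
      by (intro sum.cong) (auto simp: Suc_diff_le mult.commute)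
    then show ?thesis by (simp add: z_def)
  qed
  have bnd: "(\<Sum>i<N. z i) \<le> 1 / (1 - l * B)" for N
  proof -
    have "(\<Sum>i<Suc N. z i) = 1 + (\<Sum>i<N. l * (\<Sum>j\<le>i. z j * b (Suc (i - j))))" for N
      by (subst sum.lessThan_Suc_shift) (simp add: zrec, simp add: z_def)
    also have "(\<Sum>i<N. l * (\<Sum>j\<le>i. z j * b (Suc (i - j)))) = l * (\<Sum>j<N. z j * (\<Sum>i<N - j. b (Suc i)))" for N
    proof -
      have "(\<Sum>i<N. \<Sum>j\<le>i. z j * b (Suc (i - j))) = (\<Sum>(i,j)\<in>{(i,j). i + j < N}. z i * b (Suc j))"
        by (simp add: sum.triangle_reindex)
      also have "{(i,j). i + j < N} = Sigma {..<N} (\<lambda>i. {..<N - i})" by auto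
      also have "(\<Sum>(i,j)\<in>Sigma {..<N} (\<lambda>i. {..<N - i}). z i * b (Suc j)) = (\<Sum>j<N. z j * (\<Sum>i<N - j. b (Suc i)))"
        by (subst sum.Sigma[symmetric]) (auto simp: sum_distrib_left)
      finally show ?thesis by (simp add: sum_distrib_left[symmetric])
    qed
    finally have eq: "(\<Sum>i<Suc N. z i) = 1 + l * (\<Sum>j<N. z j * (\<Sum>i<N - j. b (Suc i)))" for N .
    have "(\<Sum>j<N. z j * (\<Sum>i<N - j. b (Suc i))) \<le> (\<Sum>j<N. z j * B)"
      unfolding B_def using z0 b by (intro sum_mono mult_left_mono sum_le_suminf sm) auto
    from mult_left_mono[OF this \<open>l \<ge> 0\<close>]
    have "l * (\<Sum>j<N. z j * (\<Sum>i<N - j. b (Suc i))) \<le> l * B * (\<Sum>i<N. z i)"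
      by (simp add: sum_distrib_right[symmetric] mult_ac sum_distrib_left[symmetric])
    then have "(\<Sum>i<N. z i) + z N \<le> 1 + l * B * (\<Sum>i<N. z i)" using eq[of N] by simp
    then have "(\<Sum>i<N. z i) * (1 - l * B) \<le> 1" using z0[of N] by (simp add: algebra_simps)
    then show ?thesis using less1 by (simp add: B_def field_simps)
  qed
  show sz: "summable (arch_z l b)"
  proof (rule bounded_imp_summable)
    show "arch_z l b n \<ge> 0" for n using z0 by (simp add: z_def)
    show "(\<Sum>k\<le>n. arch_z l b k) \<le> 1 / (1 - l * B)" for n
      using bnd[of "Suc n"] by (simp only: z_def lessThan_Suc_atMost)
  qed
  have "(\<lambda>n. \<Sum>j\<le>n. z j * b (Suc (n - j))) sums ((\<Sum>n. z n) * B)"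
    unfolding B_def using sz sm z0 b
    by (intro Cauchy_product_sums) (auto simp: z_def[symmetric])
  then have "(\<lambda>n. z (Suc n)) sums (l * ((\<Sum>n. z n) * B))"
    unfolding zrec by (rule sums_mult)
  then have "z sums (l * ((\<Sum>n. z n) * B) + z 0)"
    by (simp only: sums_Suc_iff)
  then have "(\<Sum>n. z n) = l * ((\<Sum>n. z n) * B) + z 0"
    by (rule sums_unique[symmetric])
  moreover have "z 0 = 1" by (simp add: z_def)
  ultimately have "(\<Sum>n. z n) * (1 - l * B) = 1" by algebra
  then show "(\<Sum>n. arch_z l b n) = 1 / (1 - l * (\<Sum>j. b (Suc j)))"
    using less1 by (simp add: z_def B_def field_simps)
qed

lemma arch_z_power_sums:
  assumes "l \<ge> 0" and b: "\<And>j. j \<ge> 1 \<Longrightarrow> b j \<ge> 0" and "t \<ge> 0"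
    and sm: "summable (\<lambda>j. b (Suc j) * t ^ Suc j)" and less1: "l * (\<Sum>j. b (Suc j) * t ^ Suc j) < 1"
  shows "summable (\<lambda>n. arch_z l b n * t ^ n)"
    and "(\<Sum>n. arch_z l b n * t ^ n) = 1 / (1 - l * (\<Sum>j. b (Suc j) * t ^ Suc j))"
  using arch_z_sums[of l "\<lambda>j. b j * t ^ j"] assms unfolding arch_z_rescale by auto

text \<open>
  Convergence and subcriticality at \<open>1 / r\<close> carry over to every smaller non-negative
  point; for \<open>r \<le> 1\<close> these include \<open>1\<close> and \<open>r\<close>.
\<close>

lemma subcritical_mono:
  assumes b: "\<And>j. j \<ge> 1 \<Longrightarrow> b j \<ge> 0" and "l \<ge> 0"
    and sm: "summable (\<lambda>j. b (Suc j) / r ^ Suc j)"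
    and less1: "l * (\<Sum>j. b (Suc j) / r ^ Suc j) < (1 :: real)"
    and t: "t \<ge> 0" "\<And>n. t ^ n \<le> 1 / r ^ n"
  shows "summable (\<lambda>j. b (Suc j) * t ^ Suc j)" and "l * (\<Sum>j. b (Suc j) * t ^ Suc j) < 1"
proof -
  have le: "b (Suc j) * t ^ Suc j \<le> b (Suc j) / r ^ Suc j" for j
    using mult_left_mono[OF t(2)[of "Suc j"] b[of "Suc j"]] by simp
  show *: "summable (\<lambda>j. b (Suc j) * t ^ Suc j)"
    using le b t(1) by (intro summable_comparison_test'[OF sm]) auto
  have "(\<Sum>j. b (Suc j) * t ^ Suc j) \<le> (\<Sum>j. b (Suc j) / r ^ Suc j)"
    using le by (intro suminf_le * sm)
  then have "l * (\<Sum>j. b (Suc j) * t ^ Suc j) \<le> l * (\<Sum>j. b (Suc j) / r ^ Suc j)"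
    using \<open>l \<ge> 0\<close> by (rule mult_left_mono)
  with less1 show "l * (\<Sum>j. b (Suc j) * t ^ Suc j) < 1" by linarith
qed

lemma geometric_tails_summable:
  fixes b :: "nat \<Rightarrow> real"
  assumes b: "\<And>j. j \<ge> 1 \<Longrightarrow> b j \<ge> 0" and r: "0 < r" "r < 1"
    and sm: "summable (\<lambda>j. b (Suc j) / r ^ Suc j)"
  shows "summable (\<lambda>n. \<Sum>j. b (Suc n + j))"
proof -
  define f where "f j = b (Suc j) / r ^ Suc j" for j
  have f0: "f j \<ge> 0" for j using b[of "Suc j"] r by (simp add: f_def)
  have sf: "summable f" using sm by (simp add: f_def[abs_def])
  have sfn: "summable (\<lambda>j. f (j + n))" for n by (rule summable_ignore_initial_segment[OF sf])
  have le: "b (Suc n + j) \<le> r ^ n * f (j + n)" for n j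
  proof -
    have "r ^ Suc (j + n) \<le> r ^ n" using r by (intro power_decreasing) auto
    then have "r ^ Suc (j + n) * f (j + n) \<le> r ^ n * f (j + n)" using f0 by (rule mult_right_mono)
    moreover have "r ^ Suc (j + n) * f (j + n) = b (Suc n + j)"
      unfolding f_def using r by (simp add: add.commute)
    ultimately show ?thesis by simp
  qed
  have sb: "summable (\<lambda>j. b (Suc n + j))" for n
    by (rule summable_comparison_test'[OF summable_mult[OF sfn[of n], of "r ^ n"]]) (use le b in simp)
  show ?thesis
  proof (rule summable_comparison_test')
    show "summable (\<lambda>n. r ^ n * suminf f)"
      using r by (intro summable_mult2 summable_geometric) auto
    fix n
    have "(\<Sum>j. b (Suc n + j)) \<le> (\<Sum>j. r ^ n * f (j + n))"
      by (intro suminf_le le sb summable_mult sfn)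
    also have "\<dots> = r ^ n * (\<Sum>j. f (j + n))" by (rule suminf_mult[OF sfn])
    also have "(\<Sum>j. f (j + n)) \<le> suminf f"
      using suminf_split_initial_segment[OF sf, of n] sum_nonneg[of "{..<n}" f] f0 by simp
    finally have "(\<Sum>j. b (Suc n + j)) \<le> r ^ n * suminf f" using r by simp
    moreover have "(\<Sum>j. b (Suc n + j)) \<ge> 0" using b by (intro suminf_nonneg sb) auto
    ultimately show "norm (\<Sum>j. b (Suc n + j)) \<le> r ^ n * suminf f" by simp
  qed
qed

section \<open>Decay of the renewal sequence\<close>

lemma sum_split_ends:
  fixes f :: "nat \<Rightarrow> real"
  assumes "m \<ge> 1" and "n \<ge> 2 * m"
  shows "(\<Sum>j<n. f j) = (\<Sum>j<m. f j) + (\<Sum>j = m..n - m. f j) + (\<Sum>i = 1..<m. f (n - i))"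
proof -
  have "(\<Sum>j<n. f j) = (\<Sum>j<m. f j) + (\<Sum>j = m..<n. f j)"
    using assms by (simp add: sum.atLeastLessThan_concat lessThan_atLeast0)
  also have "(\<Sum>j = m..<n. f j) = (\<Sum>j = m..<Suc (n - m). f j) + (\<Sum>j = Suc (n - m)..<n. f j)"
    using assms by (simp add: sum.atLeastLessThan_concat del: sum.op_ivl_Suc)
  also have "(\<Sum>j = Suc (n - m)..<n. f j) = (\<Sum>i = 1..<m. f (n - i))"
    using assms by (intro sum.reindex_bij_witness[of _ "\<lambda>i. n - i" "\<lambda>i. n - i"]) auto
  finally show ?thesis by (simp add: atLeastLessThanSuc_atLeastAtMost del: sum.op_ivl_Suc)
qed

text \<open>
  By \<open>step\<close>, the infimum of the eventual upper bounds of \<open>g\<close>, which is its upper limit, is at most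
  \<open>q\<close> times itself.
\<close>

lemma contraction_tendsto_0:
  fixes g :: "nat \<Rightarrow> real"
  assumes g0: "\<And>n. g n \<ge> 0" and gc: "\<forall>n\<ge>N. g n \<le> c" and "q < 1"
    and step: "\<And>K \<delta>. \<lbrakk>K \<ge> 0; \<delta> > 0; \<forall>\<^sub>F n in sequentially. g n \<le> K\<rbrakk>
        \<Longrightarrow> \<forall>\<^sub>F n in sequentially. g n \<le> q * K + \<delta>" and "q \<ge> 0"
  shows "g \<longlonglongrightarrow> 0"
proof -
  define S where "S = {K. K \<ge> 0 \<and> (\<forall>\<^sub>F n in sequentially. g n \<le> K)}"
  have "c \<ge> 0" using g0[of N] gc by force
  then have "c \<in> S" using gc unfolding S_def eventually_sequentially by blast
  then have ne: "S \<noteq> {}" by auto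
  have bdd: "bdd_below S" by (auto simp: S_def bdd_below_def)
  have "Inf S \<ge> 0" using ne by (intro cInf_greatest) (auto simp: S_def)
  have "Inf S = 0"
  proof (rule ccontr)
    assume "Inf S \<noteq> 0"
    with \<open>Inf S \<ge> 0\<close> have s: "Inf S > 0" by simp
    define \<eta> where "\<eta> = (1 - q) * Inf S / 4"
    have "\<eta> > 0" using s \<open>q < 1\<close> by (simp add: \<eta>_def)
    then obtain K where K: "K \<in> S" "K < Inf S + \<eta>"
      using cInf_lessD[OF ne, of "Inf S + \<eta>"] by auto
    then have "q * K + \<eta> \<in> S"
      using step[of K \<eta>] \<open>\<eta> > 0\<close> \<open>q \<ge> 0\<close> by (auto simp: S_def)
    then have "Inf S \<le> q * K + \<eta>" using bdd by (intro cInf_lower)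
    also have "q * K \<le> q * (Inf S + \<eta>)" using K \<open>q \<ge> 0\<close> by (intro mult_left_mono) auto
    also have "q * (Inf S + \<eta>) + \<eta> \<le> q * Inf S + 2 * \<eta>"
      using \<open>q < 1\<close> \<open>\<eta> > 0\<close> by (simp add: algebra_simps)
    also have "\<dots> < Inf S" using s \<open>q < 1\<close> by (simp add: \<eta>_def field_simps)
    finally show False by simp
  qed
  show ?thesis
  proof (rule order_tendstoI)
    fix e :: real assume "e > 0"
    then obtain K where "K \<in> S" "K < e" using cInf_lessD[OF ne, of e] \<open>Inf S = 0\<close> by auto
    then show "\<forall>\<^sub>F n in sequentially. g n < e"
      by (auto simp: S_def elim: eventually_mono)
  next
    fix e :: real assume "e < 0"
    then show "\<forall>\<^sub>F n in sequentially. e < g n"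
      using g0 by (intro always_eventually allI) (rule less_le_trans)
  qed
qed

text \<open>
  Both statements split the convolution defining \<open>z n\<close> at \<open>m\<close> and \<open>n - m\<close>. The weight class makes
  the middle part small, the first part has a limit by the ratio condition, and the last part is
  approximately \<open>q\<close> times an average of earlier quotients \<open>z i / b i\<close>. Boundedness of these
  quotients comes first because it is needed to control the middle part in the limit statement.
\<close>

lemma arch_z_weight_class1:
  assumes "l > 0" and b: "b \<in> weight_class1 r" and "r > 0"
    and sm: "summable (\<lambda>j. b (Suc j) / r ^ Suc j)"
    and less1: "l * (\<Sum>j. b (Suc j) / r ^ Suc j) < 1"
  shows arch_z_bounded_by_weight: "\<exists>C>0. \<forall>n\<ge>1. arch_z l b n \<le> C * b n"
    and arch_z_asymp: "(\<lambda>n. arch_z l b n / b n) \<longlonglongrightarrow> l / (1 - l * (\<Sum>j. b (Suc j) / r ^ Suc j))\<^sup>2"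
proof -
  define z where "z = arch_z l b"
  define q where "q = l * (\<Sum>j. b (Suc j) / r ^ Suc j)"
  have q1: "q < 1" using less1 by (simp add: q_def)
  have bpos: "b n > 0" if "n \<ge> 1" for n using weight_class1_pos[OF b that] .
  have b0: "b n \<ge> 0" if "n \<ge> 1" for n using bpos[OF that] by simp
  have z0: "z n \<ge> 0" for n unfolding z_def using b0 \<open>l > 0\<close> by (intro arch_z_nonneg) auto
  have zrec: "z n = l * (\<Sum>j<n. b (n - j) * z j)" if "n \<ge> 1" for n
    using that unfolding z_def by (cases n) (auto simp: lessThan_Suc_atMost atMost_atLeast0)
  \<comment> \<open>The shares of the three ranges: \<open>P\<close> has small \<open>j\<close>, \<open>Q\<close> is the middle, and \<open>U\<close> weighs the
    quotients \<open>z / b\<close> at the end; \<open>Pm\<close> and \<open>Um\<close> are the limits of \<open>P\<close> and \<open>U\<close> in \<open>n\<close>.\<close>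
  define U where "U m n = (\<Sum>i = 1..<m. b i * (b (n - i) / b n))" for m n
  define P where "P m n = (\<Sum>j<m. z j * (b (n - j) / b n))" for m n
  define Q where "Q m n = (\<Sum>j = m..n - m. b (n - j) * z j) / b n" for m n
  define Um where "Um m = (\<Sum>i = 1..<m. b i / r ^ i)" for m
  define Pm where "Pm m = (\<Sum>j<m. z j / r ^ j)" for m
  have U_lim: "(\<lambda>n. U m n) \<longlonglongrightarrow> Um m" for m
  proof -
    have "(\<lambda>n. U m n) \<longlonglongrightarrow> (\<Sum>i\<in>{1..<m}. b i * (1 / r ^ i))"
      unfolding U_def by (intro tendsto_sum tendsto_mult_left weight_class1_ratio[OF b])
    then show ?thesis by (simp add: Um_def)
  qed
  have P_lim: "(\<lambda>n. P m n) \<longlonglongrightarrow> Pm m" for m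
  proof -
    have "(\<lambda>n. P m n) \<longlonglongrightarrow> (\<Sum>i\<in>{..<m}. z i * (1 / r ^ i))"
      unfolding P_def by (intro tendsto_sum tendsto_mult_left weight_class1_ratio[OF b])
    then show ?thesis by (simp add: Pm_def)
  qed
  have Um_eq: "Um m = (\<Sum>j<m - 1. b (Suc j) / r ^ Suc j)" for m
    unfolding Um_def
    by (rule sum.reindex_bij_witness[of _ Suc "\<lambda>i. i - 1"]) auto
  have Um_lim: "(\<lambda>m. l * Um m) \<longlonglongrightarrow> q"
    unfolding Um_eq q_def
    by (intro tendsto_mult_left filterlim_compose[OF summable_LIMSEQ[OF sm]] filterlim_minus_const_nat_at_top)
  have Um_le: "l * Um m \<le> q" for m
    unfolding Um_eq q_def using \<open>l > 0\<close> b0 \<open>r > 0\<close> by (intro mult_left_mono sum_le_suminf sm) auto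
  have q0: "q \<ge> 0" using Um_le[of 0] by (simp add: Um_def)
  have zs: "summable (\<lambda>n. z n / r ^ n)" "(\<Sum>n. z n / r ^ n) = 1 / (1 - q)"
  proof -
    have eq: "x * (1 / r) ^ n = x / r ^ n" for x n by (simp add: power_one_over)
    show "summable (\<lambda>n. z n / r ^ n)" "(\<Sum>n. z n / r ^ n) = 1 / (1 - q)"
      using arch_z_power_sums[of l b "1 / r", unfolded eq] assms b0 by (auto simp: z_def q_def)
  qed
  have Pm_lim: "(\<lambda>m. l * Pm m) \<longlonglongrightarrow> l / (1 - q)"
    using tendsto_mult_left[OF summable_LIMSEQ[OF zs(1)], of l] zs(2) by (simp add: Pm_def)
  have z_split: "z n / b n = l * P m n + l * Q m n + l * (\<Sum>i = 1..<m. b i * (z (n - i) / b n))"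
    if "m \<ge> 1" "n \<ge> 2 * m" for m n
  proof -
    have "z n = l * ((\<Sum>j<m. b (n - j) * z j) + (\<Sum>j = m..n - m. b (n - j) * z j)
        + (\<Sum>i = 1..<m. b (n - (n - i)) * z (n - i)))"
      using that zrec[of n] by (simp add: sum_split_ends)
    also have "(\<Sum>i = 1..<m. b (n - (n - i)) * z (n - i)) = (\<Sum>i = 1..<m. b i * z (n - i))"
      using that by (intro sum.cong) auto
    finally show ?thesis
      unfolding P_def Q_def
      by (simp add: distrib_left add_divide_distrib mult.commute flip: sum_divide_distrib)
  qed
  have Q_le: "Q m n \<le> C * e"
    if "\<And>j. 1 \<le> j \<Longrightarrow> j < n \<Longrightarrow> z j \<le> C * b j" "m \<ge> 1" "n \<ge> 2 * m" "C \<ge> 0"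
      "(\<Sum>j = m..n - m. b (n - j) * b j) \<le> e * b n" for C e m n
  proof -
    have "(\<Sum>j = m..n - m. b (n - j) * z j) \<le> (\<Sum>j = m..n - m. b (n - j) * (C * b j))"
      using that b0 by (intro sum_mono mult_left_mono) auto
    also have "\<dots> = C * (\<Sum>j = m..n - m. b (n - j) * b j)"
      by (simp add: sum_distrib_left mult_ac)
    also have "\<dots> \<le> C * (e * b n)" using that by (intro mult_left_mono) auto
    finally show ?thesis unfolding Q_def using bpos[of n] that by (simp add: field_simps)
  qed
  have "\<exists>C>0. \<forall>n\<ge>1. z n \<le> C * b n"
  proof -
    \<comment> \<open>The end and the middle part together then multiply a bound on the earlier quotients by at most
      \<open>q + 2 * \<delta> < 1\<close>.\<close>
    define \<delta> where "\<delta> = (1 - q) / 4"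
    have "\<delta> > 0" using q1 by (simp add: \<delta>_def)
    have "\<forall>\<^sub>F m in sequentially. \<forall>\<^sub>F n in sequentially.
       (\<Sum>i = m..n - m. b (n - i) * b i) \<le> \<delta> / l * b n"
      using \<open>\<delta> > 0\<close> \<open>l > 0\<close> by (intro weight_class1_mid[OF b]) simp
    then have ev_m: "\<forall>\<^sub>F m in sequentially. m \<ge> 1 \<and> (\<forall>\<^sub>F n in sequentially.
       (\<Sum>i = m..n - m. b (n - i) * b i) \<le> \<delta> / l * b n)"
      using eventually_ge_at_top[of 1] by eventually_elim simp
    from eventually_happens'[OF sequentially_bot ev_m]
    obtain m where m: "m \<ge> 1" and mid: "\<forall>\<^sub>F n in sequentially.
       (\<Sum>i = m..n - m. b (n - i) * b i) \<le> \<delta> / l * b n"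
      by blast
    have "\<forall>\<^sub>F n in sequentially. P m n < Pm m + 1"
      using P_lim by (rule order_tendstoD) simp
    moreover have "\<forall>\<^sub>F n in sequentially. l * U m n < q + \<delta>"
      using tendsto_mult_left[OF U_lim, of l m] Um_le[of m] \<open>\<delta> > 0\<close> by (intro order_tendstoD(2)) auto
    ultimately have "\<forall>\<^sub>F n in sequentially. P m n < Pm m + 1 \<and> l * U m n < q + \<delta> \<and>
        (\<Sum>i = m..n - m. b (n - i) * b i) \<le> \<delta> / l * b n \<and> n \<ge> 2 * m"
      using mid eventually_ge_at_top[of "2 * m"] by eventually_elim simp
    then obtain N where N: "\<And>n. n \<ge> N \<Longrightarrow> P m n < Pm m + 1 \<and> l * U m n < q + \<delta> \<and>
        (\<Sum>i = m..n - m. b (n - i) * b i) \<le> \<delta> / l * b n \<and> n \<ge> 2 * m"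
      unfolding eventually_sequentially by blast
    \<comment> \<open>The first summand covers the indices up to \<open>N\<close>; the second one makes \<open>C\<close> reproduce itself
      under the estimate above.\<close>
    define C where "C = (\<Sum>i = 1..N. z i / b i) + l * (Pm m + 1) / (1 - q - 2 * \<delta>)"
    have Pm0: "Pm m \<ge> 0" unfolding Pm_def using z0 \<open>r > 0\<close> by (simp add: sum_nonneg)
    have gap: "1 - q - 2 * \<delta> > 0" using q1 by (simp add: \<delta>_def field_simps)
    have S0: "(\<Sum>i = 1..N. z i / b i) \<ge> 0" using z0 b0 by (auto intro!: sum_nonneg)
    have "C > 0" unfolding C_def using S0 gap Pm0 \<open>l > 0\<close>
      by (intro add_nonneg_pos divide_pos_pos mult_pos_pos) auto
    have C2: "l * (Pm m + 1) \<le> C * (1 - q - 2 * \<delta>)"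
    proof -
      have "C * (1 - q - 2 * \<delta>) = (\<Sum>i = 1..N. z i / b i) * (1 - q - 2 * \<delta>) + l * (Pm m + 1)"
        unfolding C_def distrib_right using gap by simp
      then show ?thesis using mult_nonneg_nonneg[OF S0 less_imp_le[OF gap]] by simp
    qed
    have "n \<ge> 1 \<Longrightarrow> z n \<le> C * b n" for n
    proof (induction n rule: less_induct)
      case (less n)
      show ?case
      proof (cases "n \<le> N")
        case True
        have "z n / b n \<le> (\<Sum>i = 1..N. z i / b i)"
          using True less.prems z0 b0 by (intro member_le_sum) auto
        also have "\<dots> \<le> C" unfolding C_def using gap Pm0 \<open>l > 0\<close> by simp
        finally show ?thesis using bpos[OF less.prems] by (simp add: field_simps)
      next
        case False
        then have n: "P m n < Pm m + 1" "l * U m n < q + \<delta>"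
          "(\<Sum>i = m..n - m. b (n - i) * b i) \<le> \<delta> / l * b n" "n \<ge> 2 * m" using N[of n] by auto
        have IH: "z j \<le> C * b j" if "1 \<le> j" "j < n" for j using less that by auto
        have "Q m n \<le> C * (\<delta> / l)" using IH m n \<open>C > 0\<close> by (intro Q_le) auto
        then have "l * Q m n \<le> C * \<delta>" using \<open>l > 0\<close> by (simp add: field_simps)
        moreover have "l * P m n \<le> l * (Pm m + 1)" using n \<open>l > 0\<close> by simp
        moreover have "l * (\<Sum>i = 1..<m. b i * (z (n - i) / b n)) \<le> C * (q + \<delta>)"
        proof -
          have "(\<Sum>i = 1..<m. b i * (z (n - i) / b n)) \<le> (\<Sum>i = 1..<m. b i * (C * b (n - i) / b n))"
            using n b0 IH less.prems by (intro sum_mono mult_left_mono divide_right_mono) auto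
          also have "\<dots> = C * U m n" by (simp add: U_def sum_distrib_left mult_ac)
          finally have "l * (\<Sum>i = 1..<m. b i * (z (n - i) / b n)) \<le> C * (l * U m n)"
            using \<open>l > 0\<close> by (simp add: mult.left_commute)
          also have "\<dots> \<le> C * (q + \<delta>)" using n \<open>C > 0\<close> by simp
          finally show ?thesis .
        qed
        ultimately have "z n / b n \<le> l * (Pm m + 1) + C * \<delta> + C * (q + \<delta>)"
          using z_split[OF m n(4)] by linarith
        also have "\<dots> \<le> C" using C2 by (simp add: algebra_simps)
        finally show ?thesis using bpos[OF less.prems] by (simp add: field_simps)
      qed
    qed
    with \<open>C > 0\<close> show ?thesis by blast
  qed
  then show "\<exists>C>0. \<forall>n\<ge>1. arch_z l b n \<le> C * b n" by (simp add: z_def)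
  then obtain C where "C > 0" and C: "\<And>n. n \<ge> 1 \<Longrightarrow> z n \<le> C * b n" by (auto simp: z_def)
  define A where "A = l / (1 - q)\<^sup>2"
  have "A \<ge> 0" using \<open>l > 0\<close> by (simp add: A_def)
  \<comment> \<open>\<open>A\<close> is the fixed point of \<open>x \<mapsto> l / (1 - q) + q * x\<close>.\<close>
  have A_eq: "l / (1 - q) = A * (1 - q)" using q1 by (simp add: A_def power2_eq_square)
  define g where "g n = \<bar>z n / b n - A\<bar>" for n
  have "g \<longlonglongrightarrow> 0"
  proof (rule contraction_tendsto_0[where N = 1 and c = "C + A", OF _ _ q1 _ q0])
    show "\<forall>n\<ge>1. g n \<le> C + A"
    proof (intro allI impI)
      fix n :: nat assume "n \<ge> 1"
      then have "z n / b n \<le> C" using C bpos by (simp add: field_simps)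
      moreover have "z n / b n \<ge> 0" using \<open>n \<ge> 1\<close> z0 b0 by simp
      ultimately show "g n \<le> C + A" unfolding g_def using \<open>A \<ge> 0\<close> \<open>C > 0\<close> by linarith
    qed
  next
    fix K \<delta> :: real
    assume "K \<ge> 0" "\<delta> > 0" and K: "\<forall>\<^sub>F n in sequentially. g n \<le> K"
    \<comment> \<open>Four errors occur, bounded by \<open>\<eta>\<close>, \<open>\<eta>\<close>, \<open>\<eta> * K\<close> and \<open>A * \<eta>\<close>.\<close>
    define \<eta> where "\<eta> = \<delta> / (2 + K + A)"
    have "\<eta> > 0" using \<open>K \<ge> 0\<close> \<open>A \<ge> 0\<close> \<open>\<delta> > 0\<close> by (simp add: \<eta>_def)
    have \<delta>: "\<delta> = \<eta> * (2 + K + A)" using \<open>K \<ge> 0\<close> \<open>A \<ge> 0\<close> by (simp add: \<eta>_def)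
    have "\<forall>\<^sub>F m in sequentially. dist (l * Pm m) (l / (1 - q)) < \<eta>"
      using Pm_lim \<open>\<eta> > 0\<close> by (rule tendstoD)
    moreover have "\<forall>\<^sub>F m in sequentially. dist (l * Um m) q < \<eta>"
      using Um_lim \<open>\<eta> > 0\<close> by (rule tendstoD)
    moreover have "\<forall>\<^sub>F m in sequentially. \<forall>\<^sub>F n in sequentially.
       (\<Sum>i = m..n - m. b (n - i) * b i) \<le> \<eta> / (l * C) * b n"
      using \<open>\<eta> > 0\<close> \<open>l > 0\<close> \<open>C > 0\<close> by (intro weight_class1_mid[OF b]) simp
    ultimately have ev_m: "\<forall>\<^sub>F m in sequentially. dist (l * Pm m) (l / (1 - q)) < \<eta> \<and> dist (l * Um m) q < \<eta> \<and>
       (\<forall>\<^sub>F n in sequentially. (\<Sum>i = m..n - m. b (n - i) * b i) \<le> \<eta> / (l * C) * b n) \<and> m \<ge> 1"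
      using eventually_ge_at_top[of 1] by eventually_elim simp
    from eventually_happens'[OF sequentially_bot ev_m]
    obtain m where m: "dist (l * Pm m) (l / (1 - q)) < \<eta>" "dist (l * Um m) q < \<eta>"
       "\<forall>\<^sub>F n in sequentially. (\<Sum>i = m..n - m. b (n - i) * b i) \<le> \<eta> / (l * C) * b n" "m \<ge> 1"
      by blast
    obtain N where N: "\<And>n. n \<ge> N \<Longrightarrow> g n \<le> K" using K by (auto simp: eventually_sequentially)
    have "\<forall>\<^sub>F n in sequentially. dist (l * P m n) (l / (1 - q)) < \<eta>"
      by (rule order_tendstoD(2)[OF tendsto_dist[OF tendsto_mult_left[OF P_lim] tendsto_const] m(1)])
    moreover have "\<forall>\<^sub>F n in sequentially. dist (l * U m n) q < \<eta>"
      by (rule order_tendstoD(2)[OF tendsto_dist[OF tendsto_mult_left[OF U_lim] tendsto_const] m(2)])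
    ultimately show "\<forall>\<^sub>F n in sequentially. g n \<le> q * K + \<delta>"
      using m(3) eventually_ge_at_top[of "2 * m + N + 1"]
    proof eventually_elim
      case (elim n)
      then have n: "n \<ge> 2 * m" "n \<ge> 1" by auto
      have "Q m n \<le> C * (\<eta> / (l * C))" using C n m elim \<open>C > 0\<close> by (intro Q_le) auto
      then have lQ: "l * Q m n \<le> \<eta>" using \<open>l > 0\<close> \<open>C > 0\<close> by (simp add: field_simps)
      have "Q m n \<ge> 0" unfolding Q_def using n m z0 b0
        by (intro divide_nonneg_nonneg sum_nonneg mult_nonneg_nonneg) auto
      then have lQ0: "l * Q m n \<ge> 0" using \<open>l > 0\<close> by simp
      have w: "b (n - i) / b n * (z (n - i) / b (n - i)) = z (n - i) / b n" if "i < m" for i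
      proof -
        have "b (n - i) > 0" using that n m(4) by (intro bpos) auto
        then show ?thesis by simp
      qed
      have "(\<Sum>i = 1..<m. b i * (z (n - i) / b n)) - A * U m n
          = (\<Sum>i = 1..<m. b i * (b (n - i) / b n) * (z (n - i) / b (n - i) - A))"
      proof -
        have "(\<Sum>i = 1..<m. b i * (b (n - i) / b n) * (z (n - i) / b (n - i) - A))
           = (\<Sum>i = 1..<m. b i * (z (n - i) / b n) - A * (b i * (b (n - i) / b n)))"
        proof (intro sum.cong refl)
          fix i assume "i \<in> {1..<m}"
          then have "b i * (z (n - i) / b n) = b i * (b (n - i) / b n * (z (n - i) / b (n - i)))"
            using w[of i] by (simp only: atLeastLessThan_iff)
          then show "b i * (b (n - i) / b n) * (z (n - i) / b (n - i) - A)
             = b i * (z (n - i) / b n) - A * (b i * (b (n - i) / b n))"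
            by (simp only: right_diff_distrib mult_ac)
        qed
        then show ?thesis by (simp add: U_def sum_subtractf sum_distrib_left)
      qed
      also have "\<bar>\<dots>\<bar> \<le> (\<Sum>i = 1..<m. \<bar>b i * (b (n - i) / b n) * (z (n - i) / b (n - i) - A)\<bar>)"
        by (rule sum_abs)
      also have "\<dots> \<le> (\<Sum>i = 1..<m. b i * (b (n - i) / b n) * K)"
      proof (intro sum_mono)
        fix i assume i: "i \<in> {1..<m}"
        have "\<bar>z (n - i) / b (n - i) - A\<bar> \<le> K" 
          using N[of "n - i"] elim(4) i by (auto simp: g_def)
        moreover have "b i * (b (n - i) / b n) \<ge> 0" 
          using i n by (intro mult_nonneg_nonneg divide_nonneg_nonneg b0) auto
        ultimately show "\<bar>b i * (b (n - i) / b n) * (z (n - i) / b (n - i) - A)\<bar> \<le> b i * (b (n - i) / b n) * K"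
          unfolding abs_mult[of "b i * (b (n - i) / b n)"] by (simp only: abs_of_nonneg mult_left_mono)
      qed
      also have "\<dots> = U m n * K" by (simp add: U_def sum_distrib_right)
      finally have "l * \<bar>(\<Sum>i = 1..<m. b i * (z (n - i) / b n)) - A * U m n\<bar> \<le> l * (U m n * K)"
        using \<open>l > 0\<close> by simp
      also have "\<dots> \<le> (q + \<eta>) * K"
      proof -
        have "l * U m n \<le> q + \<eta>" using elim by (simp add: dist_real_def)
        from mult_right_mono[OF this \<open>K \<ge> 0\<close>] show ?thesis by (simp add: mult.assoc)
      qed
      finally have t3: "\<bar>l * ((\<Sum>i = 1..<m. b i * (z (n - i) / b n)) - A * U m n)\<bar> \<le> (q + \<eta>) * K"
        using \<open>l > 0\<close> by (simp add: abs_mult)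
      have t4: "\<bar>A * (l * U m n - q)\<bar> \<le> A * \<eta>"
        using elim \<open>A \<ge> 0\<close> by (simp add: abs_mult dist_real_def mult_left_mono)
      have t1: "\<bar>l * P m n - l / (1 - q)\<bar> \<le> \<eta>" using elim by (simp add: dist_real_def)
      have "z n / b n - A = (l * P m n - l / (1 - q)) + l * Q m n
          + l * ((\<Sum>i = 1..<m. b i * (z (n - i) / b n)) - A * U m n) + A * (l * U m n - q)"
        unfolding z_split[OF m(4) n(1)] A_eq by (simp add: algebra_simps)
      then have "g n \<le> \<eta> + \<eta> + (q + \<eta>) * K + A * \<eta>"
        unfolding g_def using t1 t3 t4 lQ lQ0 by linarith
      also have "\<dots> = q * K + \<delta>" unfolding \<delta> by (simp add: algebra_simps)
      finally show ?case .
    qed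
  qed (simp add: g_def)
  then have "(\<lambda>n. z n / b n - A) \<longlonglongrightarrow> 0" unfolding g_def by (simp only: tendsto_rabs_zero_iff)
  then have "(\<lambda>n. z n / b n) \<longlonglongrightarrow> A" by (simp only: LIM_zero_iff)
  then show "(\<lambda>n. arch_z l b n / b n) \<longlonglongrightarrow> l / (1 - l * (\<Sum>j. b (Suc j) / r ^ Suc j))\<^sup>2"
    by (simp add: z_def A_def q_def)
qed

text \<open>
  Termwise, \<open>z (n + j) / b n\<close> tends to \<open>A * r ^ j\<close>, where \<open>A\<close> is the limit of \<open>z n / b n\<close>. As
  \<open>r < 1\<close>, the weights eventually decrease, hence \<open>z (n + j) / b n\<close> is bounded uniformly in \<open>j\<close> and
  \<open>z\<close> itself is a summable majorant up to a constant.
\<close>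

lemma arch_z_autocorrelation_asymp:
  assumes "l > 0" and b: "b \<in> weight_class1 r" and "0 < r" and "r < 1"
    and sm: "summable (\<lambda>j. b (Suc j) / r ^ Suc j)"
    and less1: "l * (\<Sum>j. b (Suc j) / r ^ Suc j) < 1"
  shows "(\<lambda>n. (\<Sum>j. arch_z l b j * arch_z l b (n + j)) / b n) \<longlonglongrightarrow>
    l / (1 - l * (\<Sum>j. b (Suc j) / r ^ Suc j))\<^sup>2 / (1 - l * (\<Sum>j. b (Suc j) * r ^ Suc j))"
proof -
  define z where "z = arch_z l b"
  define A where "A = l / (1 - l * (\<Sum>j. b (Suc j) / r ^ Suc j))\<^sup>2"
  have bpos: "b n > 0" if "n \<ge> 1" for n using weight_class1_pos[OF b that] .
  have b0: "b n \<ge> 0" if "n \<ge> 1" for n using bpos[OF that] by simp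
  have z0: "z n \<ge> 0" for n unfolding z_def using b0 \<open>l > 0\<close> by (intro arch_z_nonneg) auto
  have rpow: "r ^ n \<le> 1 / r ^ n" "r ^ n \<le> 1" "1 \<le> 1 / r ^ n" for n
  proof -
    show le1: "r ^ n \<le> 1" using \<open>0 < r\<close> \<open>r < 1\<close> by (simp add: power_le_one)
    then show "1 \<le> 1 / r ^ n" using \<open>0 < r\<close> by simp
    with le1 show "r ^ n \<le> 1 / r ^ n" by linarith
  qed
  note scale = subcritical_mono[of b l r, OF b0 less_imp_le[OF \<open>l > 0\<close>] sm less1]
  have zsum: "summable z"
    unfolding z_def using scale[of 1] rpow \<open>l > 0\<close> b0 by (intro arch_z_sums) auto
  have zr: "(\<Sum>n. z n * r ^ n) = 1 / (1 - l * (\<Sum>j. b (Suc j) * r ^ Suc j))"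
    unfolding z_def using scale[of r] rpow \<open>l > 0\<close> b0 \<open>0 < r\<close> by (intro arch_z_power_sums) auto
  have asym: "(\<lambda>n. z n / b n) \<longlonglongrightarrow> A"
    unfolding z_def A_def using assms by (intro arch_z_asymp) auto
  obtain C where "C > 0" and C: "\<And>n. n \<ge> 1 \<Longrightarrow> z n \<le> C * b n"
    using arch_z_bounded_by_weight[OF \<open>l > 0\<close> b \<open>0 < r\<close> sm less1] by (auto simp: z_def)
  have shift: "(\<lambda>n. b (n + j) / b n) \<longlonglongrightarrow> r ^ j" for j
  proof -
    have "(\<lambda>n. b (n + j - j) / b (n + j)) \<longlonglongrightarrow> 1 / r ^ j"
      by (intro filterlim_compose[OF weight_class1_ratio[OF b]] filterlim_add_const_nat_at_top)
    then have "(\<lambda>n. inverse (b (n + j - j) / b (n + j))) \<longlonglongrightarrow> inverse (1 / r ^ j)"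
      using \<open>0 < r\<close> by (intro tendsto_inverse) auto
    then show ?thesis by simp
  qed
  have "\<forall>\<^sub>F n in sequentially. b (n + 1) / b n < 1"
    using shift[of 1] \<open>r < 1\<close> by (intro order_tendstoD(2)) auto
  then obtain N where N: "\<And>n. n \<ge> N \<Longrightarrow> b (n + 1) / b n < 1"
    by (auto simp: eventually_sequentially)
  have decr: "b (n + j) \<le> b n" if "n \<ge> N" "n \<ge> 1" for n j
  proof (induction j)
    case (Suc j)
    have "b (n + j) > 0" using that by (intro bpos) auto
    with N[of "n + j"] that have "b (n + j + 1) \<le> b (n + j)" by simp
    with Suc show ?case by simp
  qed simp
  have "(\<lambda>n. \<Sum>j. z j * (z (n + j) / b n)) \<longlonglongrightarrow> (\<Sum>j. z j * (A * r ^ j))"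
  proof (rule tannerys_theorem[THEN conjunct2, THEN conjunct2])
    fix j
    have "(\<lambda>n. z (n + j) / b (n + j)) \<longlonglongrightarrow> A"
      by (intro filterlim_compose[OF asym] filterlim_add_const_nat_at_top)
    from tendsto_mult[OF this shift[of j]]
    have "(\<lambda>n. z (n + j) / b (n + j) * (b (n + j) / b n)) \<longlonglongrightarrow> A * r ^ j" .
    moreover have "\<forall>\<^sub>F n in sequentially. z (n + j) / b (n + j) * (b (n + j) / b n) = z (n + j) / b n"
      using eventually_ge_at_top[of 1]
    proof eventually_elim
      case (elim n)
      then have "b (n + j) > 0" by (intro bpos) auto
      then show ?case by simp
    qed
    ultimately show "(\<lambda>n. z j * (z (n + j) / b n)) \<longlonglongrightarrow> z j * (A * r ^ j)"
      by (intro tendsto_mult_left) (rule Lim_transform_eventually)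
  next
    have "norm (z j * (z (n + j) / b n)) \<le> z j * C" if "n \<ge> N + 1" for j n
    proof -
      have "z (n + j) \<le> C * b (n + j)" using that by (intro C) auto
      also have "\<dots> \<le> C * b n" using that \<open>C > 0\<close> by (intro mult_left_mono decr) auto
      finally have "z (n + j) / b n \<le> C" using bpos[of n] that by (simp add: pos_divide_le_eq)
      from mult_left_mono[OF this z0[of j]] have "z j * (z (n + j) / b n) \<le> z j * C" .
      moreover have "z j * (z (n + j) / b n) \<ge> 0" using z0 b0[of n] that by simp
      ultimately show ?thesis by (simp only: real_norm_def abs_of_nonneg)
    qed
    then show "\<forall>\<^sub>F (j, n) in at_top \<times>\<^sub>F sequentially. norm (z j * (z (n + j) / b n)) \<le> z j * C"
      by (intro eventually_prod_sequentially[THEN iffD2] exI[of _ "N + 1"]) auto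
    show "summable (\<lambda>j. z j * C)" using zsum by (rule summable_mult2)
  qed simp
  moreover have "(\<Sum>j. z j * (z (n + j) / b n)) = (\<Sum>j. z j * z (n + j)) / b n" for n
  proof -
    obtain Z where Z: "\<And>j. z j \<le> Z"
      using summable_imp_Bseq[OF zsum] unfolding Bseq_def real_norm_def abs_le_iff by blast
    have "summable (\<lambda>j. z j * z (n + j))"
    proof (rule summable_comparison_test')
      show "summable (\<lambda>j. z j * Z)" using zsum by (rule summable_mult2)
      show "norm (z j * z (n + j)) \<le> z j * Z" for j
        using z0[of j] z0[of "n + j"] Z[of "n + j"] by (simp add: abs_mult mult_left_mono)
    qed
    from suminf_divide[OF this, of "b n"] show ?thesis by simp
  qed
  moreover have "(\<Sum>j. z j * (A * r ^ j)) = A / (1 - l * (\<Sum>j. b (Suc j) * r ^ Suc j))"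
  proof -
    have "summable (\<lambda>n. z n * r ^ n)"
      unfolding z_def using scale[of r] rpow \<open>l > 0\<close> b0 \<open>0 < r\<close> by (intro arch_z_power_sums) auto
    from suminf_mult[OF this, of A] show ?thesis unfolding zr by (simp add: mult_ac)
  qed
  ultimately show ?thesis by (simp add: z_def A_def)
qed

section \<open>Expanding linear recursions backwards in time\<close>

text \<open>
  This makes the remainders of expansions vanish: \<open>g i\<close> bounds the weight of the chains which have
  reached depth \<open>i\<close>, and \<open>T\<close> bounds the weight of a jump from there across level \<open>N\<close>.
\<close>

lemma convolution_vanishing_summable:
  fixes g T :: "nat \<Rightarrow> real"
  assumes g: "g \<longlonglongrightarrow> 0" and T: "summable T" and T0: "\<And>n. T n \<ge> 0"
  shows "(\<lambda>N. \<Sum>i<N. g i * T (N - Suc i)) \<longlonglongrightarrow> 0"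
proof -
  have "Bseq g" using g by (intro convergent_imp_Bseq) (auto simp: convergent_def)
  then obtain C where "C > 0" and C: "\<And>n. norm (g n) \<le> C" by (auto elim: BseqE)
  define a where "a k N = (if k < N then g (N - Suc k) * T k else 0)" for k N
  have "(\<lambda>N. suminf (\<lambda>k. a k N)) \<longlonglongrightarrow> suminf (\<lambda>_::nat. 0 :: real)"
  proof (rule tannerys_theorem[THEN conjunct2, THEN conjunct2])
    show "(\<lambda>N. a k N) \<longlonglongrightarrow> 0" for k
    proof -
      have "(\<lambda>N. g (N - Suc k)) \<longlonglongrightarrow> 0"
        by (intro filterlim_compose[OF g] filterlim_minus_const_nat_at_top)
      then have "(\<lambda>N. g (N - Suc k) * T k) \<longlonglongrightarrow> 0"
        by (rule tendsto_mult_left_zero)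
      moreover have "\<forall>\<^sub>F N in sequentially. g (N - Suc k) * T k = a k N"
        using eventually_gt_at_top[of k] by eventually_elim (simp add: a_def)
      ultimately show ?thesis by (rule Lim_transform_eventually)
    qed
    show "\<forall>\<^sub>F (k, N) in at_top \<times>\<^sub>F sequentially. norm (a k N) \<le> C * T k"
      using C T0 \<open>C > 0\<close>
      by (intro always_eventually) (auto simp: a_def abs_mult intro!: mult_right_mono)
    show "summable (\<lambda>k. C * T k)" using T by (rule summable_mult)
  qed simp
  moreover have "suminf (\<lambda>k. a k N) = (\<Sum>i<N. g i * T (N - Suc i))" for N
  proof -
    have "suminf (\<lambda>k. a k N) = (\<Sum>k<N. g (N - Suc k) * T k)"
      by (subst suminf_finite[of "{..<N}"]) (auto simp: a_def)
    also have "\<dots> = (\<Sum>i<N. g i * T (N - Suc i))"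
      by (subst sum.nat_diff_reindex[symmetric]) (auto intro!: sum.cong)
    finally show ?thesis .
  qed
  ultimately show ?thesis by simp
qed

text \<open>
  \<open>renewal b x k n\<close> sums over all chains \<open>k = t\<^sub>0 > t\<^sub>1 > \<dots> > t\<^sub>p = k - n\<close> the products of the
  weights \<open>b (t\<^sub>i - t\<^sub>i\<^sub>+\<^sub>1)\<close> of the jumps and the values \<open>x t\<^sub>i\<close> at all points but the last. For
  constant \<open>x\<close> this is the sequence \<open>arch_z\<close>.
\<close>

fun renewal :: "(nat \<Rightarrow> real) \<Rightarrow> (int \<Rightarrow> real) \<Rightarrow> int \<Rightarrow> nat \<Rightarrow> real" where
  "renewal b x k 0 = 1"
| "renewal b x k (Suc n) = (\<Sum>j = 0..n. b (Suc n - j) * (x (k - int j) * renewal b x k j))"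

lemma renewal_const: "renewal b (\<lambda>_. l) k n = arch_z l b n"
proof (induction n rule: less_induct)
  case (less n)
  show ?case
  proof (cases n)
    case (Suc m)
    have "(\<Sum>j = 0..m. b (Suc m - j) * (l * renewal b (\<lambda>_. l) k j)) = (\<Sum>j = 0..m. l * (b (Suc m - j) * arch_z l b j))"
      using less Suc by (intro sum.cong) auto
    then show ?thesis using Suc by (simp add: sum_distrib_left)
  qed simp
qed

text \<open>
  Iterating the equation, a chain is followed until its next jump crosses level \<open>k - N\<close>; the inner
  series over \<open>j\<close> collects the jumps that land on \<open>k - (N + 1) - j\<close>. Raising \<open>N\<close> by one substitutes
  the equation at the single time \<open>k - (N + 1)\<close>, at which all chains landing there have total weight
  \<open>renewal b x k (N + 1)\<close>. The lemma is applied to the process itself, and with constant \<open>x\<close> to its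
  autocovariance function.
\<close>

lemma renewal_expansion:
  fixes x y \<alpha> :: "int \<Rightarrow> real"
  assumes sm: "\<And>k. summable (\<lambda>j. b (Suc j) * y (k - int (Suc j)))"
    and eq: "\<And>k. y k = x k * (\<alpha> k + (\<Sum>j. b (Suc j) * y (k - int (Suc j))))"
  shows "y k = (\<Sum>i<Suc N. x (k - int i) * renewal b x k i *
    (\<alpha> (k - int i) + (\<Sum>j. b (Suc N - i + j) * y (k - int (Suc N) - int j))))"
proof (induction N)
  case 0
  show ?case using eq[of k] by (simp add: algebra_simps)
next
  case (Suc N)
  define M where "M = Suc N"
  define R where "R i M = (\<Sum>j. b (M - i + j) * y (k - int M - int j))" for i M
  have split: "R i M = b (M - i) * y (k - int M) + R i (Suc M)" if "i < M" for i
  proof -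
    have "summable (\<lambda>j. b (Suc (j + (M - Suc i))) * y (k - int i - int (Suc (j + (M - Suc i)))))"
      by (rule summable_ignore_initial_segment[OF sm])
    moreover have "b (Suc (j + (M - Suc i))) * y (k - int i - int (Suc (j + (M - Suc i))))
        = b (M - i + j) * y (k - int M - int j)" for j
    proof -
      have "Suc (j + (M - Suc i)) = M - i + j" using that by simp
      moreover have "k - int i - int (M - i + j) = k - int M - int j" using that by simp
      ultimately show ?thesis by (simp only:)
    qed
    ultimately have "summable (\<lambda>j. b (M - i + j) * y (k - int M - int j))" by simp
    from suminf_split_head[OF this]
    have "R i M = (\<Sum>j. b (M - i + Suc j) * y (k - int M - int (Suc j))) + b (M - i) * y (k - int M)"
      by (simp add: R_def)
    also have "(\<Sum>j. b (M - i + Suc j) * y (k - int M - int (Suc j))) = R i (Suc M)"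
      unfolding R_def using that by (intro suminf_cong) (simp add: Suc_diff_le diff_diff_eq add_ac)
    finally show ?thesis by simp
  qed
  have "y k = (\<Sum>i<M. x (k - int i) * renewal b x k i * (\<alpha> (k - int i) + R i M))"
    using Suc unfolding M_def R_def .
  also have "\<dots> = (\<Sum>i<M. x (k - int i) * renewal b x k i * (\<alpha> (k - int i) + R i (Suc M))
      + b (M - i) * (x (k - int i) * renewal b x k i) * y (k - int M))"
    by (intro sum.cong refl) (simp add: split algebra_simps)
  also have "\<dots> = (\<Sum>i<M. x (k - int i) * renewal b x k i * (\<alpha> (k - int i) + R i (Suc M)))
      + renewal b x k M * y (k - int M)"
    by (simp add: sum.distrib sum_distrib_right M_def lessThan_Suc_atMost atMost_atLeast0)
  also have "y (k - int M) = x (k - int M) * (\<alpha> (k - int M) + R M (Suc M))"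
  proof -
    have "R M (Suc M) = (\<Sum>j. b (Suc j) * y (k - int M - int (Suc j)))"
      unfolding R_def by (simp add: diff_diff_eq add_ac)
    then show ?thesis using eq[of "k - int M"] by simp
  qed
  finally show ?case by (simp add: M_def[symmetric] R_def mult_ac)
qed

section \<open>Square integrable functions and series\<close>

definition sq_integrable :: "'w measure \<Rightarrow> ('w \<Rightarrow> real) \<Rightarrow> bool" where
  "sq_integrable M f \<longleftrightarrow> f \<in> borel_measurable M \<and> integrable M (\<lambda>\<omega>. (f \<omega>)\<^sup>2)"

lemma sq_integrable_mult:
  assumes "sq_integrable M f" and "sq_integrable M g"
  shows "integrable M (\<lambda>\<omega>. f \<omega> * g \<omega>)"
proof (rule Bochner_Integration.integrable_bound)
  show "integrable M (\<lambda>\<omega>. (f \<omega>)\<^sup>2 + (g \<omega>)\<^sup>2)"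
    using assms by (auto simp: sq_integrable_def)
  show "(\<lambda>\<omega>. f \<omega> * g \<omega>) \<in> borel_measurable M"
    using assms by (auto simp: sq_integrable_def)
  have "\<bar>x * y\<bar> \<le> x\<^sup>2 + y\<^sup>2" for x y :: real
  proof -
    have "2 * (\<bar>x\<bar> * \<bar>y\<bar>) \<le> x\<^sup>2 + y\<^sup>2" using sum_squares_bound[of "\<bar>x\<bar>" "\<bar>y\<bar>"] by simp
    moreover have "0 \<le> \<bar>x\<bar> * \<bar>y\<bar>" by simp
    ultimately show ?thesis unfolding abs_mult by linarith
  qed
  then show "AE \<omega> in M. norm (f \<omega> * g \<omega>) \<le> norm ((f \<omega>)\<^sup>2 + (g \<omega>)\<^sup>2)" by simp
qed

lemma sq_integrable_scale: "sq_integrable M f \<Longrightarrow> sq_integrable M (\<lambda>\<omega>. c * f \<omega>)"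
  by (auto simp: sq_integrable_def power_mult_distrib)

lemma sq_integrable_add:
  assumes "sq_integrable M f" and "sq_integrable M g"
  shows "sq_integrable M (\<lambda>\<omega>. f \<omega> + g \<omega>)"
proof -
  have "integrable M (\<lambda>\<omega>. (f \<omega>)\<^sup>2 + (g \<omega>)\<^sup>2 + 2 * (f \<omega> * g \<omega>))"
    using assms sq_integrable_mult[OF assms] by (auto simp: sq_integrable_def)
  then show ?thesis using assms by (auto simp: sq_integrable_def power2_sum mult.assoc)
qed

lemma sq_integrable_diff:
  assumes "sq_integrable M f" and "sq_integrable M g"
  shows "sq_integrable M (\<lambda>\<omega>. f \<omega> - g \<omega>)"
  using sq_integrable_add[OF assms(1) sq_integrable_scale[OF assms(2), of "-1"]] by simp

lemma sq_integrable_sum: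
  assumes "\<And>i. i \<in> I \<Longrightarrow> sq_integrable M (f i)"
  shows "sq_integrable M (\<lambda>\<omega>. \<Sum>i\<in>I. f i \<omega>)"
  using assms
proof (induction I rule: infinite_finite_induct)
  case (insert i I)
  then show ?case by (auto intro: sq_integrable_add)
qed (simp_all add: sq_integrable_def)

lemma (in finite_measure) sq_integrable_const: "sq_integrable M (\<lambda>_. c)"
  by (simp add: sq_integrable_def)

lemma (in finite_measure) sq_integrable_integrable: "sq_integrable M f \<Longrightarrow> integrable M f"
  by (auto simp: sq_integrable_def intro: square_integrable_imp_integrable)

text \<open>
  The Cauchy-Schwarz inequality, from the non-negative quadratic polynomial
  \<open>t \<mapsto> \<integral> (\<bar>f\<bar> - t * \<bar>g\<bar>)\<^sup>2\<close>.
\<close>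

lemma integral_abs_mult_le:
  assumes f: "sq_integrable M f" and g: "sq_integrable M g"
  shows "(\<integral>\<omega>. \<bar>f \<omega> * g \<omega>\<bar> \<partial>M) \<le> sqrt (\<integral>\<omega>. (f \<omega>)\<^sup>2 \<partial>M) * sqrt (\<integral>\<omega>. (g \<omega>)\<^sup>2 \<partial>M)"
proof -
  define a c b where "a = (\<integral>\<omega>. (f \<omega>)\<^sup>2 \<partial>M)" and "c = (\<integral>\<omega>. (g \<omega>)\<^sup>2 \<partial>M)"
    and "b = (\<integral>\<omega>. \<bar>f \<omega> * g \<omega>\<bar> \<partial>M)"
  have a0: "a \<ge> 0" and c0: "c \<ge> 0" and b0: "b \<ge> 0" by (simp_all add: a_def b_def c_def)
  have int: "integrable M (\<lambda>\<omega>. (f \<omega>)\<^sup>2)" "integrable M (\<lambda>\<omega>. (g \<omega>)\<^sup>2)"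
    "integrable M (\<lambda>\<omega>. \<bar>f \<omega> * g \<omega>\<bar>)"
    using f g sq_integrable_mult[OF f g] by (auto simp: sq_integrable_def)
  have quad: "2 * t * b \<le> a + t\<^sup>2 * c" for t
  proof -
    have "0 \<le> (\<integral>\<omega>. (\<bar>f \<omega>\<bar> - t * \<bar>g \<omega>\<bar>)\<^sup>2 \<partial>M)" by (rule Bochner_Integration.integral_nonneg) simp
    also have "\<dots> = (\<integral>\<omega>. (f \<omega>)\<^sup>2 + t\<^sup>2 * (g \<omega>)\<^sup>2 - 2 * t * \<bar>f \<omega> * g \<omega>\<bar> \<partial>M)"
      by (intro Bochner_Integration.integral_cong refl)
        (simp add: power2_diff power_mult_distrib abs_mult mult_ac)
    also have "\<dots> = a + t\<^sup>2 * c - 2 * t * b"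
      using int by (simp add: a_def b_def c_def)
    finally show ?thesis by simp
  qed
  have "b\<^sup>2 \<le> a * c"
  proof (cases "c = 0")
    case True
    have "b = 0"
    proof (rule ccontr)
      assume "b \<noteq> 0"
      then show False using quad[of "(a + 1) / (2 * b)"] True by simp
    qed
    then show ?thesis using True by simp
  next
    case False
    with c0 have "c > 0" by simp
    \<comment> \<open>The polynomial is minimal at \<open>t = b / c\<close>.\<close>
    have "2 * (b / c) * b \<le> a + (b / c)\<^sup>2 * c" by (rule quad)
    then show ?thesis using \<open>c > 0\<close> by (simp add: field_simps power2_eq_square)
  qed
  then have "b \<le> sqrt (a * c)" by (rule real_le_rsqrt)
  then show ?thesis by (simp add: a_def b_def c_def real_sqrt_mult)
qed

text \<open>
  Almost sure absolute convergence follows from the summability of the integrals by monotone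
  convergence; the rest is termwise integration.
\<close>

lemma L1_series:
  fixes f :: "nat \<Rightarrow> 'w \<Rightarrow> real"
  assumes int: "\<And>i. integrable M (f i)" and sm: "summable (\<lambda>i. \<integral>\<omega>. \<bar>f i \<omega>\<bar> \<partial>M)"
  shows L1_series_AE_summable: "AE \<omega> in M. summable (\<lambda>i. \<bar>f i \<omega>\<bar>)"
    and L1_series_integrable: "integrable M (\<lambda>\<omega>. \<Sum>i. f i \<omega>)"
    and L1_series_sums: "(\<lambda>i. \<integral>\<omega>. f i \<omega> \<partial>M) sums (\<integral>\<omega>. (\<Sum>i. f i \<omega>) \<partial>M)"
proof -
  have [measurable]: "f i \<in> borel_measurable M" for i using int[of i] by simp
  have "(\<integral>\<^sup>+\<omega>. (\<Sum>i. ennreal \<bar>f i \<omega>\<bar>) \<partial>M) = (\<Sum>i. \<integral>\<^sup>+\<omega>. ennreal \<bar>f i \<omega>\<bar> \<partial>M)"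
    by (rule nn_integral_suminf) simp
  also have "\<dots> = (\<Sum>i. ennreal (\<integral>\<omega>. \<bar>f i \<omega>\<bar> \<partial>M))"
    using int by (intro suminf_cong nn_integral_eq_integral) auto
  also have "\<dots> \<noteq> \<infinity>" 
    unfolding infinity_ennreal_def by (intro ennreal_suminf_neq_top sm Bochner_Integration.integral_nonneg) auto
  finally have "AE \<omega> in M. (\<Sum>i. ennreal \<bar>f i \<omega>\<bar>) \<noteq> \<infinity>"
    by (intro nn_integral_noteq_infinite) auto
  then show AE: "AE \<omega> in M. summable (\<lambda>i. \<bar>f i \<omega>\<bar>)"
    by eventually_elim (rule summable_suminf_not_top, auto)
  show "integrable M (\<lambda>\<omega>. \<Sum>i. f i \<omega>)"
    using int AE sm by (intro integrable_suminf) auto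
  show "(\<lambda>i. \<integral>\<omega>. f i \<omega> \<partial>M) sums (\<integral>\<omega>. (\<Sum>i. f i \<omega>) \<partial>M)"
    using int AE sm by (intro sums_integral) auto
qed

text \<open>
  The Cauchy-Schwarz inequality for \<open>sqrt (c j)\<close> and \<open>sqrt (c j) * x j\<close>.
\<close>

lemma suminf_weighted_square_le:
  fixes c x :: "nat \<Rightarrow> real"
  assumes c0: "\<And>j. c j \<ge> 0" and c: "summable c" and cx: "summable (\<lambda>j. c j * (x j)\<^sup>2)"
  shows "(\<Sum>j. c j * x j)\<^sup>2 \<le> (\<Sum>j. c j) * (\<Sum>j. c j * (x j)\<^sup>2)"
proof -
  have "summable (\<lambda>j. c j * x j)"
  proof (rule summable_comparison_test')
    show "summable (\<lambda>j. c j + c j * (x j)\<^sup>2)" using c cx by (rule summable_add)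
    fix j
    have "\<bar>x j\<bar> \<le> 1 + (x j)\<^sup>2" using sum_squares_bound[of 1 "\<bar>x j\<bar>"] by simp
    then have "c j * \<bar>x j\<bar> \<le> c j * (1 + (x j)\<^sup>2)" using c0 by (rule mult_left_mono)
    then show "norm (c j * x j) \<le> c j + c j * (x j)\<^sup>2"
      using c0[of j] by (simp add: abs_mult distrib_left)
  qed
  then have "(\<lambda>n. (\<Sum>j<n. c j * x j)\<^sup>2) \<longlonglongrightarrow> (\<Sum>j. c j * x j)\<^sup>2"
    by (intro tendsto_power summable_LIMSEQ)
  moreover have "(\<lambda>n. (\<Sum>j<n. c j) * (\<Sum>j<n. c j * (x j)\<^sup>2)) \<longlonglongrightarrow> (\<Sum>j. c j) * (\<Sum>j. c j * (x j)\<^sup>2)"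
    by (intro tendsto_mult summable_LIMSEQ c cx)
  moreover have "(\<Sum>j<n. c j * x j)\<^sup>2 \<le> (\<Sum>j<n. c j) * (\<Sum>j<n. c j * (x j)\<^sup>2)" for n
  proof -
    have "c j * x j = sqrt (c j) * (sqrt (c j) * x j)" for j
      using c0[of j] by (simp flip: mult.assoc)
    then have "(\<Sum>j<n. c j * x j)\<^sup>2 = (\<Sum>j<n. sqrt (c j) * (sqrt (c j) * x j))\<^sup>2" by presburger
    also have "\<dots> \<le> (\<Sum>j<n. (sqrt (c j))\<^sup>2) * (\<Sum>j<n. (sqrt (c j) * x j)\<^sup>2)"
      by (rule Cauchy_Schwarz_ineq_sum)
    also have "\<dots> = (\<Sum>j<n. c j) * (\<Sum>j<n. c j * (x j)\<^sup>2)"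
      using c0 by (simp add: power_mult_distrib)
    finally show ?thesis .
  qed
  ultimately show ?thesis by (intro LIMSEQ_le) auto
qed

lemma sq_integrable_series:
  fixes c :: "nat \<Rightarrow> real"
  assumes c0: "\<And>j. c j \<ge> 0" and c: "summable c" and f: "\<And>j. sq_integrable M (f j)"
    and bnd: "\<And>j. (\<integral>\<omega>. (f j \<omega>)\<^sup>2 \<partial>M) \<le> C"
  shows "sq_integrable M (\<lambda>\<omega>. \<Sum>j. c j * f j \<omega>)" (is ?thesis1)
    and "(\<integral>\<omega>. (\<Sum>j. c j * f j \<omega>)\<^sup>2 \<partial>M) \<le> (\<Sum>j. c j)\<^sup>2 * C" (is ?thesis2)
proof -
  have [measurable]: "f j \<in> borel_measurable M" for j using f[of j] by (simp add: sq_integrable_def)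
  have int: "integrable M (\<lambda>\<omega>. c j * (f j \<omega>)\<^sup>2)" for j using f[of j] by (simp add: sq_integrable_def)
  have le: "(\<integral>\<omega>. c j * (f j \<omega>)\<^sup>2 \<partial>M) \<le> c j * C" for j
    using bnd[of j] c0[of j] by (simp add: mult_left_mono)
  have sm: "summable (\<lambda>j. \<integral>\<omega>. c j * (f j \<omega>)\<^sup>2 \<partial>M)"
  proof (rule summable_comparison_test')
    show "summable (\<lambda>j. c j * C)" using c by (rule summable_mult2)
    show "norm (\<integral>\<omega>. c j * (f j \<omega>)\<^sup>2 \<partial>M) \<le> c j * C" for j
      using le[of j] c0[of j] by simp
  qed
  then have sm': "summable (\<lambda>j. \<integral>\<omega>. \<bar>c j * (f j \<omega>)\<^sup>2\<bar> \<partial>M)" using c0 by simp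
  have "AE \<omega> in M. summable (\<lambda>j. \<bar>c j * (f j \<omega>)\<^sup>2\<bar>)"
    by (rule L1_series_AE_summable[OF int sm'])
  then have AE: "AE \<omega> in M. (\<Sum>j. c j * f j \<omega>)\<^sup>2 \<le> (\<Sum>j. c j) * (\<Sum>j. c j * (f j \<omega>)\<^sup>2)"
  proof eventually_elim
    case (elim \<omega>)
    then show ?case using c0 c by (intro suminf_weighted_square_le) auto
  qed
  have int2: "integrable M (\<lambda>\<omega>. (\<Sum>j. c j) * (\<Sum>j. c j * (f j \<omega>)\<^sup>2))"
    using L1_series_integrable[OF int sm'] by (rule integrable_mult_right)
  have int1: "integrable M (\<lambda>\<omega>. (\<Sum>j. c j * f j \<omega>)\<^sup>2)"
  proof (rule Bochner_Integration.integrable_bound[OF int2])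
    show "AE \<omega> in M. norm ((\<Sum>j. c j * f j \<omega>)\<^sup>2) \<le> norm ((\<Sum>j. c j) * (\<Sum>j. c j * (f j \<omega>)\<^sup>2))"
      using AE by eventually_elim simp
  qed simp
  then show ?thesis1 by (simp add: sq_integrable_def)
  have "(\<integral>\<omega>. (\<Sum>j. c j * f j \<omega>)\<^sup>2 \<partial>M) \<le> (\<integral>\<omega>. (\<Sum>j. c j) * (\<Sum>j. c j * (f j \<omega>)\<^sup>2) \<partial>M)"
    using int1 int2 AE by (rule integral_mono_AE)
  also have "\<dots> = (\<Sum>j. c j) * (\<Sum>j. \<integral>\<omega>. c j * (f j \<omega>)\<^sup>2 \<partial>M)"
    using sums_unique[OF L1_series_sums[OF int sm']] by simp
  also have "(\<Sum>j. \<integral>\<omega>. c j * (f j \<omega>)\<^sup>2 \<partial>M) \<le> (\<Sum>j. c j * C)"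
    using le sm c by (intro suminf_le summable_mult2)
  also have "(\<Sum>j. c j * C) = (\<Sum>j. c j) * C" using suminf_mult2[OF c, of C] by simp
  finally show ?thesis2
    using suminf_nonneg[OF c c0] by (simp add: power2_eq_square mult.assoc mult_left_mono)
qed

section \<open>Independence of present and past noise\<close>

locale iid_noise = prob_space M for M :: "'w measure" +
  fixes \<xi> :: "int \<Rightarrow> 'w \<Rightarrow> real"
  assumes indep: "indep_vars (\<lambda>_. borel) \<xi> UNIV"
    and same_distr: "distr M borel (\<xi> k) = distr M borel (\<xi> 0)"
    and noise0_square: "integrable M (\<lambda>\<omega>. (\<xi> 0 \<omega>)\<^sup>2)"
begin

definition lam :: real where "lam = expectation (\<xi> 0)"

definition var :: real where "var = variance (\<xi> 0)"

lemma noise_measurable [measurable]: "\<xi> k \<in> borel_measurable M"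
  using indep by (simp add: indep_vars_def)

lemma noise_transfer:
  assumes [measurable]: "f \<in> borel_measurable borel"
  shows "integrable M (\<lambda>\<omega>. f (\<xi> k \<omega>)) \<longleftrightarrow> integrable M (\<lambda>\<omega>. f (\<xi> 0 \<omega>))"
    and "expectation (\<lambda>\<omega>. f (\<xi> k \<omega>)) = expectation (\<lambda>\<omega>. (f (\<xi> 0 \<omega>) :: real))"
proof -
  have "integrable (distr M borel (\<xi> k)) f \<longleftrightarrow> integrable (distr M borel (\<xi> 0)) f"
    by (subst same_distr) simp
  then show "integrable M (\<lambda>\<omega>. f (\<xi> k \<omega>)) \<longleftrightarrow> integrable M (\<lambda>\<omega>. f (\<xi> 0 \<omega>))"
    by (simp add: integrable_distr_eq)
  have "integral\<^sup>L (distr M borel (\<xi> k)) f = integral\<^sup>L (distr M borel (\<xi> 0)) f"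
    by (subst same_distr) simp
  then show "expectation (\<lambda>\<omega>. f (\<xi> k \<omega>)) = expectation (\<lambda>\<omega>. f (\<xi> 0 \<omega>))"
    by (simp add: integral_distr)
qed

lemma sq_integrable_noise: "sq_integrable M (\<xi> k)"
  using noise0_square noise_transfer(1)[of "\<lambda>x. x\<^sup>2" k] by (simp add: sq_integrable_def)

lemma integrable_noise: "integrable M (\<xi> k)"
  by (rule sq_integrable_integrable[OF sq_integrable_noise])

lemma expectation_noise: "expectation (\<xi> k) = lam"
  using noise_transfer(2)[of "\<lambda>x. x" k] by (simp add: lam_def)

lemma sq_integrable_centred_noise: "sq_integrable M (\<lambda>\<omega>. \<xi> k \<omega> - lam)"
  by (intro sq_integrable_diff sq_integrable_noise sq_integrable_const)

lemma expectation_centred_noise: "expectation (\<lambda>\<omega>. \<xi> k \<omega> - lam) = 0"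
  using integrable_noise[of k] by (simp add: expectation_noise prob_space)

lemma expectation_centred_noise_square: "expectation (\<lambda>\<omega>. (\<xi> k \<omega> - lam)\<^sup>2) = var"
  using noise_transfer(2)[of "\<lambda>x. (x - lam)\<^sup>2" k] by (simp add: var_def lam_def)

lemma expectation_noise_square: "expectation (\<lambda>\<omega>. (\<xi> k \<omega>)\<^sup>2) = var + lam\<^sup>2"
proof -
  have "expectation (\<lambda>\<omega>. (\<xi> k \<omega>)\<^sup>2) = expectation (\<lambda>\<omega>. (\<xi> 0 \<omega>)\<^sup>2)"
    by (rule noise_transfer) simp
  then show ?thesis
    using variance_eq[OF integrable_noise[of 0] noise0_square] by (simp add: var_def lam_def)
qed

text \<open>
  The \<open>\<sigma>\<close>-algebra generated by \<open>\<xi> i\<close> for \<open>i \<in> B\<close>, as a measurable space. A statement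
  \<open>Y \<in> borel_measurable (history B)\<close> says that \<open>Y\<close> is a function of this part of the noise, and it
  is closed under all operations, including series, which preserve measurability.
\<close>

definition history :: "int set \<Rightarrow> 'w measure" where
  "history B = vimage_algebra (space M) (\<lambda>\<omega>. \<lambda>i\<in>B. \<xi> i \<omega>) (PiM B (\<lambda>_. borel))"

lemma noise_paths_measurable: "(\<lambda>\<omega>. \<lambda>i\<in>B. \<xi> i \<omega>) \<in> measurable M (PiM B (\<lambda>_. borel))"
  by (intro measurable_restrict) simp

lemma noise_paths_funcset: "(\<lambda>\<omega>. \<lambda>i\<in>B. \<xi> i \<omega>) \<in> space M \<rightarrow> space (PiM B (\<lambda>_. borel))"
  by (intro Pi_I measurable_space[OF noise_paths_measurable])

lemma history_sets:
  "sets (history B) = {(\<lambda>\<omega>. \<lambda>i\<in>B. \<xi> i \<omega>) -` A \<inter> space M | A. A \<in> sets (PiM B (\<lambda>_. borel))}"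
  unfolding history_def by (rule sets_vimage_algebra2[OF noise_paths_funcset])

lemma space_history: "space (history B) = space M"
  by (simp add: history_def)

lemma history_measurable_id: "(\<lambda>\<omega>. \<omega>) \<in> measurable M (history B)"
  using noise_paths_measurable[of B]
  by (auto simp: measurable_def space_history history_sets)

lemma history_measurable_global:
  "Y \<in> borel_measurable (history B) \<Longrightarrow> Y \<in> borel_measurable M"
  using measurable_compose[OF history_measurable_id] by auto

lemma noise_history_measurable:
  assumes "i \<in> B" shows "\<xi> i \<in> borel_measurable (history B)"
proof -
  have "(\<lambda>\<omega>. \<lambda>i\<in>B. \<xi> i \<omega>) \<in> measurable (history B) (PiM B (\<lambda>_. borel))"
    unfolding history_def by (rule measurable_vimage_algebra1[OF noise_paths_funcset])
  from measurable_compose[OF this measurable_component_singleton[OF assms]] assms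
  show ?thesis by simp
qed

text \<open>
  Independence of the two restrictions of the noise path is a statement about the
  \<open>\<sigma>\<close>-algebras which they generate, and these contain the ones generated by \<open>U\<close> and \<open>V\<close>.
\<close>

lemma indep_disjoint_histories:
  fixes U V :: "'w \<Rightarrow> real"
  assumes "A \<inter> B = {}" and U: "U \<in> borel_measurable (history A)" and V: "V \<in> borel_measurable (history B)"
  shows "indep_var borel U borel V"
proof -
  have "indep_var (PiM A (\<lambda>_. borel)) (\<lambda>\<omega>. \<lambda>i\<in>A. \<xi> i \<omega>) (PiM B (\<lambda>_. borel)) (\<lambda>\<omega>. \<lambda>i\<in>B. \<xi> i \<omega>)"
    using assms(1) by (intro indep_var_restrict[OF indep]) auto
  then have hist: "indep_set (sets (history A)) (sets (history B))"
    unfolding indep_var_eq history_sets[symmetric]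
    using sets.sigma_sets_eq[of "history A"] sets.sigma_sets_eq[of "history B"]
    by (simp add: space_history)
  have sub: "sigma_sets (space M) {W -` S \<inter> space M | S. S \<in> sets borel} \<subseteq> sets (history C)"
    if W: "W \<in> borel_measurable (history C)" for W :: "'w \<Rightarrow> real" and C
  proof -
    have "{W -` S \<inter> space M | S. S \<in> sets borel} \<subseteq> sets (history C)"
      using measurable_sets[OF W] by (auto simp: space_history)
    then have "sigma_sets (space (history C)) {W -` S \<inter> space M | S. S \<in> sets borel} \<subseteq> sets (history C)"
      by (rule sets.sigma_sets_subset)
    then show ?thesis by (simp only: space_history)
  qed
  have "indep_set (sigma_sets (space M) {U -` S \<inter> space M | S. S \<in> sets borel})
      (sigma_sets (space M) {V -` S \<inter> space M | S. S \<in> sets borel})"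
    using hist unfolding indep_set_def
    by (rule indep_sets_mono_sets) (auto split: bool.split intro: subsetD[OF sub[OF U]] subsetD[OF sub[OF V]])
  then show ?thesis
    unfolding indep_var_eq using U V by (auto intro: history_measurable_global)
qed

lemma indep_noise_history:
  fixes f :: "real \<Rightarrow> real" and Y :: "'w \<Rightarrow> real"
  assumes "p \<notin> B" and "f \<in> borel_measurable borel" and "Y \<in> borel_measurable (history B)"
  shows "indep_var borel (\<lambda>\<omega>. f (\<xi> p \<omega>)) borel Y"
  using assms measurable_compose[OF noise_history_measurable[of p "{p}"]]
  by (intro indep_disjoint_histories[of "{p}" B]) auto

lemma noise_history_product:
  fixes f :: "real \<Rightarrow> real" and Y :: "'w \<Rightarrow> real"
  assumes "p \<notin> B" and "f \<in> borel_measurable borel" and "Y \<in> borel_measurable (history B)"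
    and "integrable M (\<lambda>\<omega>. f (\<xi> p \<omega>))" and "integrable M Y"
  shows noise_history_integrable: "integrable M (\<lambda>\<omega>. f (\<xi> p \<omega>) * Y \<omega>)"
    and noise_history_expectation:
      "expectation (\<lambda>\<omega>. f (\<xi> p \<omega>) * Y \<omega>) = expectation (\<lambda>\<omega>. f (\<xi> p \<omega>)) * expectation Y"
proof -
  note indep = indep_noise_history[OF assms(1-3)]
  show "integrable M (\<lambda>\<omega>. f (\<xi> p \<omega>) * Y \<omega>)"
    by (rule indep_var_integrable[OF indep assms(4,5)])
  show "expectation (\<lambda>\<omega>. f (\<xi> p \<omega>) * Y \<omega>) = expectation (\<lambda>\<omega>. f (\<xi> p \<omega>)) * expectation Y"
    by (rule indep_var_lebesgue_integral[OF indep assms(4,5)])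
qed

lemma centred_noise_orthogonal_history:
  fixes Y :: "'w \<Rightarrow> real"
  assumes "p \<notin> B" and "Y \<in> borel_measurable (history B)" and "integrable M Y"
  shows "expectation (\<lambda>\<omega>. (\<xi> p \<omega> - lam) * Y \<omega>) = 0"
  using noise_history_expectation[of p B "\<lambda>x. x - lam" Y] assms
    sq_integrable_integrable[OF sq_integrable_centred_noise[of p]]
  by (simp add: expectation_centred_noise)

lemma noise_history_square:
  fixes f :: "real \<Rightarrow> real" and Y :: "'w \<Rightarrow> real"
  assumes p: "p \<notin> B" and f: "f \<in> borel_measurable borel" and Y: "Y \<in> borel_measurable (history B)"
    and "sq_integrable M (\<lambda>\<omega>. f (\<xi> p \<omega>))" and "sq_integrable M Y"
  shows sq_integrable_noise_history: "sq_integrable M (\<lambda>\<omega>. f (\<xi> p \<omega>) * Y \<omega>)"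
    and expectation_noise_history_square: "expectation (\<lambda>\<omega>. (f (\<xi> p \<omega>) * Y \<omega>)\<^sup>2)
      = expectation (\<lambda>\<omega>. (f (\<xi> p \<omega>))\<^sup>2) * expectation (\<lambda>\<omega>. (Y \<omega>)\<^sup>2)"
proof -
  have f2: "(\<lambda>x. (f x)\<^sup>2) \<in> borel_measurable borel" using f by simp
  have Y2: "(\<lambda>\<omega>. (Y \<omega>)\<^sup>2) \<in> borel_measurable (history B)" using Y by simp
  note prod = noise_history_product[OF p f2 Y2]
  show "expectation (\<lambda>\<omega>. (f (\<xi> p \<omega>) * Y \<omega>)\<^sup>2)
      = expectation (\<lambda>\<omega>. (f (\<xi> p \<omega>))\<^sup>2) * expectation (\<lambda>\<omega>. (Y \<omega>)\<^sup>2)"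
    unfolding power_mult_distrib using assms by (intro prod) (auto simp: sq_integrable_def)
  have "integrable M (\<lambda>\<omega>. (f (\<xi> p \<omega>) * Y \<omega>)\<^sup>2)"
    unfolding power_mult_distrib using assms by (intro prod) (auto simp: sq_integrable_def)
  then show "sq_integrable M (\<lambda>\<omega>. f (\<xi> p \<omega>) * Y \<omega>)"
    using assms by (auto simp: sq_integrable_def)
qed

end

section \<open>Second moments of random renewal sequences\<close>

text \<open>
  In terms of formal power series \<open>Y = H + Y * \<beta>\<close> and \<open>Z = 1 + Z * \<beta>\<close>, where \<open>\<beta>\<close> has the
  coefficients \<open>l * b j\<close>; hence \<open>Y = H * Z\<close>.
\<close>

lemma arch_z_variation_of_constants:
  assumes y: "\<And>n. y n = h n + l * (\<Sum>j<n. b (n - j) * y j)"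
  shows "y n = (\<Sum>m\<le>n. arch_z l b (n - m) * h m)"
proof -
  define \<beta> where "\<beta> = Abs_fps (\<lambda>n. if n = 0 then 0 else l * b n)"
  define Z where "Z = Abs_fps (arch_z l b)"
  define Y where "Y = Abs_fps y"
  define H where "H = Abs_fps h"
  have conv: "fps_nth (Abs_fps f * \<beta>) n = l * (\<Sum>j<n. b (n - j) * f j)" for f :: "nat \<Rightarrow> real" and n
  proof -
    have "fps_nth (Abs_fps f * \<beta>) n = (\<Sum>j\<in>insert n {..<n}. f j * fps_nth \<beta> (n - j))"
      unfolding fps_mult_nth by (intro sum.cong) auto
    also have "\<dots> = (\<Sum>j<n. f j * fps_nth \<beta> (n - j))" by (simp add: \<beta>_def)
    also have "\<dots> = (\<Sum>j<n. l * (b (n - j) * f j))"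
      by (intro sum.cong) (auto simp: \<beta>_def)
    finally show ?thesis by (simp add: sum_distrib_left)
  qed
  have "Y = H + Y * \<beta>"
  proof (rule fps_ext)
    fix n show "fps_nth Y n = fps_nth (H + Y * \<beta>) n"
      using y[of n] conv[of y n] by (simp add: Y_def H_def)
  qed
  moreover have "Z = 1 + Z * \<beta>"
  proof (rule fps_ext)
    fix n show "fps_nth Z n = fps_nth (1 + Z * \<beta>) n"
      using conv[of "arch_z l b" n]
      by (cases n) (simp_all add: Z_def lessThan_Suc_atMost atMost_atLeast0)
  qed
  ultimately have "Y = H * Z" by algebra
  then have "fps_nth Y n = fps_nth (H * Z) n" by simp
  then show ?thesis
    by (simp add: Y_def H_def Z_def fps_mult_nth atMost_atLeast0 mult.commute)
qed

lemma renewal_nonneg: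
  assumes "\<And>j. j \<ge> 1 \<Longrightarrow> b j \<ge> 0" and "\<And>k. x k \<ge> 0"
  shows "renewal b x k n \<ge> 0"
proof (induction n rule: less_induct)
  case (less n)
  then show ?case using assms
    by (cases n) (auto intro!: sum_nonneg mult_nonneg_nonneg)
qed

text \<open>
  Splitting \<open>x = l + (x - l)\<close> turns the recursion for \<open>x (k - n) * renewal b x k n\<close> into one with
  constant coefficient \<open>l\<close> and a perturbation. If \<open>x\<close> is noise with mean \<open>l\<close>, the summands on the
  right-hand side are pairwise orthogonal, since \<open>renewal b x k m\<close> does not involve \<open>x\<close> at or before
  time \<open>k - m\<close>.
\<close>

lemma renewal_decomposition:
  "x (k - int n) * renewal b x k n =
    l * arch_z l b n + (\<Sum>m\<le>n. arch_z l b (n - m) * ((x (k - int m) - l) * renewal b x k m))"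
proof -
  define y where "y n = x (k - int n) * renewal b x k n" for n
  define d where "d n = (x (k - int n) - l) * renewal b x k n" for n
  have "y n = (d n + (if n = 0 then l else 0)) + l * (\<Sum>j<n. b (n - j) * y j)" for n
  proof (cases n)
    case (Suc m)
    have "renewal b x k n = (\<Sum>j<n. b (n - j) * y j)"
      unfolding Suc y_def by (simp add: lessThan_Suc_atMost atMost_atLeast0)
    then show ?thesis using Suc by (simp add: y_def d_def algebra_simps)
  qed (simp add: y_def d_def)
  from arch_z_variation_of_constants[OF this, of n]
  have "y n = (\<Sum>m\<le>n. arch_z l b (n - m) * (d m + (if m = 0 then l else 0)))" .
  also have "\<dots> = (\<Sum>m\<le>n. arch_z l b (n - m) * d m) + (\<Sum>m\<le>n. arch_z l b (n - m) * (if m = 0 then l else 0))"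
    by (simp only: distrib_left sum.distrib)
  also have "(\<Sum>m\<le>n. arch_z l b (n - m) * (if m = 0 then l else 0)) = l * arch_z l b n"
    by (simp add: if_distrib sum.delta mult.commute cong: if_cong)
  finally show ?thesis by (simp add: y_def d_def)
qed

text \<open>
  The solution is dominated by a multiple of \<open>arch_z \<kappa> u\<close>, to which the generating function
  applies. In fact \<open>s n = (1 + 1 / \<kappa>) * arch_z \<kappa> u n\<close> for \<open>n \<ge> 1\<close>.
\<close>

lemma summable_renewal_equation:
  fixes s u :: "nat \<Rightarrow> real"
  assumes s: "\<And>n. s n = u n + \<kappa> * (\<Sum>m<n. u (n - m) * s m)"
    and "u 0 = 1" and "\<kappa> > 0" and u0: "\<And>n. u n \<ge> 0" and s0: "\<And>n. s n \<ge> 0"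
    and u: "summable (\<lambda>j. u (Suc j))" and less1: "\<kappa> * (\<Sum>j. u (Suc j)) < 1"
  shows "summable s"
proof -
  define w where "w = arch_z \<kappa> u"
  have wrec: "w n = \<kappa> * (\<Sum>m<n. u (n - m) * w m)" if "n \<ge> 1" for n
    using that unfolding w_def by (cases n) (auto simp: lessThan_Suc_atMost atMost_atLeast0)
  have split: "(\<Sum>m<n. u (n - m) * f m) = u n * f 0 + (\<Sum>m = 1..<n. u (n - m) * f m)"
    if "n \<ge> 1" for n and f :: "nat \<Rightarrow> real"
    using that sum.atLeast_Suc_lessThan[of 0 n "\<lambda>m. u (n - m) * f m"] by (simp add: lessThan_atLeast0)
  have bound: "s n \<le> (1 + 1 / \<kappa>) * w n" if "n \<ge> 1" for n
    using that
  proof (induction n rule: less_induct)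
    case (less n)
    define R where "R = (\<Sum>m = 1..<n. u (n - m) * w m)"
    have "(\<Sum>m = 1..<n. u (n - m) * s m) \<le> (\<Sum>m = 1..<n. u (n - m) * ((1 + 1 / \<kappa>) * w m))"
      using less.IH u0 by (intro sum_mono mult_left_mono) auto
    also have "\<dots> = (1 + 1 / \<kappa>) * R"
      unfolding R_def sum_distrib_left by (intro sum.cong) (auto simp: mult_ac)
    finally have "\<kappa> * (\<Sum>m = 1..<n. u (n - m) * s m) \<le> \<kappa> * ((1 + 1 / \<kappa>) * R)"
      using \<open>\<kappa> > 0\<close> by simp
    also have "\<kappa> * ((1 + 1 / \<kappa>) * R) = (\<kappa> + 1) * R" using \<open>\<kappa> > 0\<close> by (simp add: field_simps)
    finally have "s n \<le> (\<kappa> + 1) * (u n + R)"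
      using s[of n] s[of 0] split[OF less.prems, of s] \<open>u 0 = 1\<close> by (simp add: algebra_simps)
    also have "u n + R = w n / \<kappa>"
      using wrec[OF less.prems] split[OF less.prems, of w] \<open>\<kappa> > 0\<close> by (simp add: R_def w_def)
    finally show ?case using \<open>\<kappa> > 0\<close> by (simp add: field_simps)
  qed
  have "summable w"
    unfolding w_def using \<open>\<kappa> > 0\<close> u0 u less1 by (intro arch_z_sums(1)) auto
  then have "summable (\<lambda>n. (1 + 1 / \<kappa>) * w n)" by (rule summable_mult)
  then show ?thesis
  proof (rule summable_comparison_test'[where N = 1])
    show "norm (s n) \<le> (1 + 1 / \<kappa>) * w n" if "n \<ge> 1" for n
      using bound[OF that] s0[of n] by (simp only: real_norm_def abs_of_nonneg)
  qed
qed

context iid_noise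
begin

abbreviation noise_renewal :: "(nat \<Rightarrow> real) \<Rightarrow> int \<Rightarrow> nat \<Rightarrow> 'w \<Rightarrow> real" where
  "noise_renewal b k n \<omega> \<equiv> renewal b (\<lambda>i. \<xi> i \<omega>) k n"

lemma renewal_history_measurable:
  assumes "{k - int n<..k} \<subseteq> B"
  shows "noise_renewal b k n \<in> borel_measurable (history B)"
  using assms
proof (induction n rule: less_induct)
  case (less n)
  show ?case
  proof (cases n)
    case (Suc m)
    have "\<xi> (k - int j) \<in> borel_measurable (history B)"
      "noise_renewal b k j \<in> borel_measurable (history B)" if "j \<in> {0..m}" for j
    proof -
      have "k - int j \<in> {k - int n<..k}" using that Suc by auto
      then show "\<xi> (k - int j) \<in> borel_measurable (history B)"
        using less.prems by (intro noise_history_measurable) auto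
      have "{k - int j<..k} \<subseteq> {k - int n<..k}" using that Suc by auto
      then show "noise_renewal b k j \<in> borel_measurable (history B)"
        using less that Suc by (intro less.IH) auto
    qed
    then show ?thesis unfolding Suc renewal.simps
      by (intro borel_measurable_sum borel_measurable_times borel_measurable_const) auto
  qed simp
qed

text \<open>
  The sequence at \<open>n\<close> is independent of the noise at time \<open>k - n\<close>, which is the factor multiplying it
  in the recursion.
\<close>

lemma renewal_past_measurable: "noise_renewal b k n \<in> borel_measurable (history {k - int n<..})"
  by (rule renewal_history_measurable) auto

lemma sq_integrable_renewal: "sq_integrable M (noise_renewal b k n)"
proof (induction n rule: less_induct)
  case (less n)
  show ?case
  proof (cases n)
    case 0
    then show ?thesis by (simp add: sq_integrable_const)
  next
    case (Suc m)
    have "sq_integrable M (\<lambda>\<omega>. \<xi> (k - int j) \<omega> * noise_renewal b k j \<omega>)" if "j \<in> {0..m}" for j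
      using less[of j] that Suc sq_integrable_noise
      by (intro sq_integrable_noise_history[where f = "\<lambda>x. x" and B = "{k - int j<..}"]
          renewal_past_measurable) auto
    then show ?thesis unfolding Suc renewal.simps
      by (intro sq_integrable_sum sq_integrable_scale)
  qed
qed

text \<open>
  The left-hand side is the second moment of \<open>\<xi> (k - n) * noise_renewal b k n\<close> computed by
  independence, the right-hand side is the same quantity computed from the orthogonal
  decomposition.
\<close>

lemma renewal_second_moment_equation:
  fixes b :: "nat \<Rightarrow> real" and k :: int
  defines "s \<equiv> \<lambda>n. expectation (\<lambda>\<omega>. (noise_renewal b k n \<omega>)\<^sup>2)"
  shows "(var + lam\<^sup>2) * s n = lam\<^sup>2 * (arch_z lam b n)\<^sup>2 + var * (\<Sum>m\<le>n. (arch_z lam b (n - m))\<^sup>2 * s m)"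
proof -
  define D where "D m \<omega> = (\<xi> (k - int m) \<omega> - lam) * noise_renewal b k m \<omega>" for m \<omega>
  define z where "z = arch_z lam b"
  have Dsq: "sq_integrable M (D m)" for m
    unfolding D_def
    by (rule sq_integrable_noise_history[where f = "\<lambda>x. x - lam" and B = "{k - int m<..}"])
      (auto intro: renewal_past_measurable sq_integrable_centred_noise sq_integrable_renewal)
  have D2: "expectation (\<lambda>\<omega>. (D m \<omega>)\<^sup>2) = var * s m" for m
  proof -
    have "expectation (\<lambda>\<omega>. (D m \<omega>)\<^sup>2) = expectation (\<lambda>\<omega>. (\<xi> (k - int m) \<omega> - lam)\<^sup>2) * s m"
      unfolding D_def s_def
      by (rule expectation_noise_history_square[where f = "\<lambda>x. x - lam" and B = "{k - int m<..}"])
        (auto intro: renewal_past_measurable sq_integrable_centred_noise sq_integrable_renewal)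
    then show ?thesis by (simp add: expectation_centred_noise_square)
  qed
  have D1: "expectation (D m) = 0" for m
    unfolding D_def
    by (rule centred_noise_orthogonal_history[where B = "{k - int m<..}"])
      (auto intro: renewal_past_measurable sq_integrable_renewal sq_integrable_integrable)
  have Dmeas: "D m \<in> borel_measurable (history {k - int n<..})" if "m < n" for m n
  proof -
    have "\<xi> (k - int m) \<in> borel_measurable (history {k - int n<..})"
      using that by (intro noise_history_measurable) auto
    moreover have "noise_renewal b k m \<in> borel_measurable (history {k - int n<..})"
      using that by (intro renewal_history_measurable) auto
    ultimately show ?thesis unfolding D_def
      by (intro borel_measurable_times borel_measurable_diff borel_measurable_const)
  qed
  have orth_less: "expectation (\<lambda>\<omega>. D n \<omega> * D m \<omega>) = 0" if "m < n" for m n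
  proof -
    have "expectation (\<lambda>\<omega>. (\<xi> (k - int n) \<omega> - lam) * (noise_renewal b k n \<omega> * D m \<omega>)) = 0"
      using Dmeas[OF that]
      by (intro centred_noise_orthogonal_history[where B = "{k - int n<..}"]
          sq_integrable_mult Dsq sq_integrable_renewal borel_measurable_times renewal_past_measurable) auto
    then show ?thesis by (simp add: D_def mult.assoc)
  qed
  have orth: "expectation (\<lambda>\<omega>. D n \<omega> * D m \<omega>) = (if n = m then var * s m else 0)" for m n
  proof (cases m n rule: linorder_cases)
    case less then show ?thesis using orth_less by simp
  next
    case equal then show ?thesis using D2[of m] by (simp add: power2_eq_square)
  next
    case greater then show ?thesis using orth_less[of n m] by (simp add: mult.commute)
  qed
  have dec: "\<xi> (k - int n) \<omega> * noise_renewal b k n \<omega> = lam * z n + (\<Sum>m\<le>n. z (n - m) * D m \<omega>)" for \<omega>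
    using renewal_decomposition[of "\<lambda>i. \<xi> i \<omega>" k n b lam] by (simp add: z_def D_def)
  have "(var + lam\<^sup>2) * s n = expectation (\<lambda>\<omega>. (\<xi> (k - int n) \<omega> * noise_renewal b k n \<omega>)\<^sup>2)"
    unfolding s_def expectation_noise_square[of "k - int n", symmetric]
    by (rule expectation_noise_history_square[where f = "\<lambda>x. x" and B = "{k - int n<..}", symmetric])
      (auto intro: renewal_past_measurable sq_integrable_noise sq_integrable_renewal)
  also have "\<dots> = expectation (\<lambda>\<omega>. (lam * z n + (\<Sum>m\<le>n. z (n - m) * D m \<omega>))\<^sup>2)"
    unfolding dec ..
  also have "\<dots> = expectation (\<lambda>\<omega>. (lam * z n)\<^sup>2 + (\<Sum>m\<le>n. 2 * (lam * z n) * z (n - m) * D m \<omega>)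
      + (\<Sum>i\<le>n. \<Sum>j\<le>n. z (n - i) * z (n - j) * (D i \<omega> * D j \<omega>)))"
    unfolding power2_sum
    by (intro Bochner_Integration.integral_cong refl)
      (simp add: power2_eq_square[of "sum _ _"] sum_product sum_distrib_left mult_ac)
  also have "\<dots> = (lam * z n)\<^sup>2 + (\<Sum>m\<le>n. 2 * (lam * z n) * z (n - m) * expectation (D m))
      + (\<Sum>i\<le>n. \<Sum>j\<le>n. z (n - i) * z (n - j) * expectation (\<lambda>\<omega>. D i \<omega> * D j \<omega>))"
    using sq_integrable_integrable[OF Dsq] sq_integrable_mult[OF Dsq Dsq]
    by (simp add: prob_space)
  also have "\<dots> = lam\<^sup>2 * (z n)\<^sup>2 + (\<Sum>i\<le>n. (z (n - i))\<^sup>2 * (var * s i))"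
    by (simp add: D1 orth power_mult_distrib if_distrib sum.delta power2_eq_square[of "z _"] cong: if_cong)
  also have "(\<Sum>i\<le>n. (z (n - i))\<^sup>2 * (var * s i)) = var * (\<Sum>m\<le>n. (z (n - m))\<^sup>2 * s m)"
    by (simp add: sum_distrib_left mult_ac)
  finally show ?thesis by (simp add: z_def)
qed

text \<open>
  Moving the term with \<open>m = n\<close> of the moment equation to the left leaves a renewal equation whose
  total mass is \<open>var / lam\<^sup>2 * (\<Sum>j. z(j + 1)\<^sup>2)\<close>, that is \<open>\<Omega>\<^sup>2\<close>.
\<close>

lemma summable_renewal_second_moment:
  assumes lam: "lam > 0" and var: "var > 0"
    and z: "summable (\<lambda>j. (arch_z lam b (Suc j))\<^sup>2)"
    and Omega: "var * (\<Sum>j. (arch_z lam b (Suc j))\<^sup>2) < lam\<^sup>2"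
  shows "summable (\<lambda>n. expectation (\<lambda>\<omega>. (noise_renewal b k n \<omega>)\<^sup>2))" (is "summable ?s")
proof (rule summable_renewal_equation)
  define u where "u n = (arch_z lam b n)\<^sup>2" for n
  fix n :: nat
  have "{..n} = insert n {..<n}" by auto
  then have "(\<Sum>m\<le>n. u (n - m) * ?s m) = u 0 * ?s n + (\<Sum>m<n. u (n - m) * ?s m)"
    by simp
  then have "(var + lam\<^sup>2) * ?s n = lam\<^sup>2 * u n + var * (?s n + (\<Sum>m<n. u (n - m) * ?s m))"
    using renewal_second_moment_equation[where b = b and k = k and n = n] by (simp add: u_def)
  then have "lam\<^sup>2 * ?s n = lam\<^sup>2 * u n + var * (\<Sum>m<n. u (n - m) * ?s m)"
    by (simp add: algebra_simps)
  then have "?s n = (lam\<^sup>2 * u n + var * (\<Sum>m<n. u (n - m) * ?s m)) / lam\<^sup>2"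
    using lam by (simp add: nonzero_eq_divide_eq mult.commute)
  also have "\<dots> = u n + var / lam\<^sup>2 * (\<Sum>m<n. u (n - m) * ?s m)"
    using lam by (simp add: add_divide_distrib)
  finally show "?s n = (arch_z lam b n)\<^sup>2 + var / lam\<^sup>2 * (\<Sum>m<n. (arch_z lam b (n - m))\<^sup>2 * ?s m)"
    by (simp add: u_def)
  show "var / lam\<^sup>2 > 0" using lam var by simp
  show "var / lam\<^sup>2 * (\<Sum>j. (arch_z lam b (Suc j))\<^sup>2) < 1" using Omega lam by simp
qed (use z in simp_all)

end

section \<open>Stationary solutions are causal\<close>

text \<open>
  Of the decay of the weights, the probabilistic part uses only that their tails are summable.
  \<open>Omega_less_1\<close> is the condition \<open>\<Omega> < 1\<close>, squared and cleared of denominators.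
\<close>

locale arch_process = iid_noise M \<xi> for M :: "'w measure" and \<xi> :: "int \<Rightarrow> 'w \<Rightarrow> real" +
  fixes a :: real and b :: "nat \<Rightarrow> real" and X :: "int \<Rightarrow> 'w \<Rightarrow> real"
  assumes noise_nonneg: "AE \<omega> in M. \<xi> k \<omega> \<ge> 0"
    and lam_pos: "lam > 0" and var_pos: "var > 0" and a_pos: "a > 0"
    and b_nonneg: "j \<ge> 1 \<Longrightarrow> b j \<ge> 0"
    and b_summable: "summable (\<lambda>j. b (Suc j))"
    and b_tails_summable: "summable (\<lambda>n. \<Sum>j. b (Suc n + j))"
    and subcritical: "lam * (\<Sum>j. b (Suc j)) < 1"
    and Omega_less_1: "var * (\<Sum>j. (arch_z lam b (Suc j))\<^sup>2) < lam\<^sup>2"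
    and solution: "arch_solution M \<xi> a b X"
    and stationary: "weakly_stationary M X"
begin

abbreviation vol :: "int \<Rightarrow> 'w \<Rightarrow> real" where
  "vol \<equiv> volatility a b X"

definition mean :: real where "mean = expectation (X 0)"

definition square_mean :: real where "square_mean = expectation (\<lambda>\<omega>. (X 0 \<omega>)\<^sup>2)"

lemma X_measurable [measurable]: "X k \<in> borel_measurable M"
  using solution by (simp add: arch_solution_def)

lemma sq_integrable_X: "sq_integrable M (X k)"
  using stationary by (simp add: sq_integrable_def weakly_stationary_def)

lemma expectation_X: "expectation (X k) = mean"
  using stationary by (simp add: weakly_stationary_def mean_def)

lemma covariance_X: "covariance M (X i) (X j) = expectation (\<lambda>\<omega>. X i \<omega> * X j \<omega>) - mean\<^sup>2"
proof -
  have "covariance M (X i) (X j)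
      = expectation (\<lambda>\<omega>. X i \<omega> * X j \<omega> - mean * X i \<omega> - mean * X j \<omega> + mean\<^sup>2)"
    unfolding covariance_def expectation_X
    by (intro Bochner_Integration.integral_cong refl) (simp add: algebra_simps power2_eq_square)
  also have "\<dots> = expectation (\<lambda>\<omega>. X i \<omega> * X j \<omega>) - mean\<^sup>2"
    using sq_integrable_mult[OF sq_integrable_X[of i] sq_integrable_X[of j]]
      sq_integrable_integrable[OF sq_integrable_X]
    by (simp add: expectation_X prob_space power2_eq_square)
  finally show ?thesis .
qed

lemma covariance_shift: "covariance M (X n) (X (n + k)) = autocovariance M X k"
  using stationary by (auto simp: weakly_stationary_def autocovariance_def) (metis add_0)

lemma expectation_X_square: "expectation (\<lambda>\<omega>. (X k \<omega>)\<^sup>2) = square_mean"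
  using covariance_shift[of k 0] covariance_X[of k k] covariance_X[of 0 0]
  by (simp add: autocovariance_def power2_eq_square square_mean_def)

lemma square_mean_nonneg: "square_mean \<ge> 0"
  by (simp add: square_mean_def)

lemma solution_AE:
  "AE \<omega> in M. \<forall>k. summable (\<lambda>j. b (Suc j) * X (k - int (Suc j)) \<omega>) \<and>
     X k \<omega> = vol k \<omega> * \<xi> k \<omega>"
  using solution by (simp add: arch_solution_def AE_all_countable)

lemma arch_z_noise_mean_nonneg: "arch_z lam b n \<ge> 0"
  using lam_pos b_nonneg by (intro arch_z_nonneg) auto

lemma arch_z_summable: "summable (arch_z lam b)"
  using lam_pos b_nonneg b_summable subcritical by (intro arch_z_sums(1)) auto

lemma arch_z_square_summable: "summable (\<lambda>n. (arch_z lam b n)\<^sup>2)"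
proof -
  obtain Z where Z: "\<And>n. arch_z lam b n \<le> Z"
    using summable_imp_Bseq[OF arch_z_summable] unfolding Bseq_def real_norm_def abs_le_iff by blast
  show ?thesis
  proof (rule summable_comparison_test')
    show "summable (\<lambda>n. Z * arch_z lam b n)" by (rule summable_mult[OF arch_z_summable])
    show "norm ((arch_z lam b n)\<^sup>2) \<le> Z * arch_z lam b n" for n
      using mult_right_mono[OF Z arch_z_noise_mean_nonneg] by (simp add: power2_eq_square arch_z_noise_mean_nonneg)
  qed
qed

text \<open>
  These are the inner series in the expansion of the process, that is, the jumps across a level.
\<close>

lemma weighted_tail_sq_integrable:
  "sq_integrable M (\<lambda>\<omega>. \<Sum>j. b (Suc n + j) * X (k - int j) \<omega>)" (is ?thesis1)
  "expectation (\<lambda>\<omega>. (\<Sum>j. b (Suc n + j) * X (k - int j) \<omega>)\<^sup>2) \<le> (\<Sum>j. b (Suc n + j))\<^sup>2 * square_mean"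
    (is ?thesis2)
proof -
  have sm: "summable (\<lambda>j. b (Suc n + j))"
    using summable_ignore_initial_segment[OF b_summable, of n] by (simp add: add_ac)
  show ?thesis1 ?thesis2
    using sq_integrable_series[of "\<lambda>j. b (Suc n + j)" M "\<lambda>j. X (k - int j)" square_mean]
      b_nonneg sm sq_integrable_X expectation_X_square by auto
qed

lemma sq_integrable_vol: "sq_integrable M (vol k)"
proof -
  have "sq_integrable M (\<lambda>\<omega>. a + (\<Sum>j. b (Suc 0 + j) * X (k - 1 - int j) \<omega>))"
    by (intro sq_integrable_add sq_integrable_const weighted_tail_sq_integrable)
  moreover have "vol k = (\<lambda>\<omega>. a + (\<Sum>j. b (Suc 0 + j) * X (k - 1 - int j) \<omega>))"
    by (simp add: fun_eq_iff volatility_def diff_diff_eq)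
  ultimately show ?thesis by simp
qed

definition causal :: "int \<Rightarrow> 'w \<Rightarrow> real" where
  "causal k \<omega> = a * (\<Sum>i. \<xi> (k - int i) \<omega> * noise_renewal b k i \<omega>)"

lemma causal_history_measurable:
  assumes "{..k} \<subseteq> B" shows "causal k \<in> borel_measurable (history B)"
proof -
  have "\<xi> (k - int i) \<in> borel_measurable (history B)"
    "noise_renewal b k i \<in> borel_measurable (history B)" for i
    using assms by (auto intro!: noise_history_measurable renewal_history_measurable)
  then show ?thesis unfolding causal_def
    by (intro borel_measurable_times borel_measurable_const borel_measurable_suminf)
qed

text \<open>
  In the expansion of \<open>X k\<close> down to level \<open>N\<close>, the remainder \<open>R N\<close> pairs the chain weights \<open>G i\<close>
  with jumps \<open>V i N\<close> across the level. As \<open>E[G(i)\<^sup>2]\<close> tends to \<open>0\<close> and the tails of \<open>b\<close> are summable,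
  the Cauchy-Schwarz inequality gives \<open>R N \<longlonglongrightarrow> 0\<close> in mean. First moments of \<open>G i\<close> would not do,
  since independence of \<open>G i\<close> and \<open>V i N\<close> is itself a consequence of causality. Along a subsequence
  the convergence is almost sure, and since the \<open>G i\<close> are non-negative, convergence of their partial
  sums along a subsequence is convergence of the series.
\<close>

lemma solution_AE_causal: "AE \<omega> in M. X k \<omega> = causal k \<omega>"
proof -
  define G where "G i \<omega> = \<xi> (k - int i) \<omega> * noise_renewal b k i \<omega>" for i \<omega>
  define V where "V i N \<omega> = (\<Sum>j. b (Suc N - i + j) * X (k - int (Suc N) - int j) \<omega>)" for i N \<omega>
  define R where "R N \<omega> = (\<Sum>i<Suc N. G i \<omega> * V i N \<omega>)" for N \<omega>
  define T where "T n = (\<Sum>j. b (Suc n + j))" for n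
  define g where "g i = expectation (\<lambda>\<omega>. (G i \<omega>)\<^sup>2)" for i
  have Gsq: "sq_integrable M (G i)" for i
    unfolding G_def
    by (rule sq_integrable_noise_history[where f = "\<lambda>x. x" and B = "{k - int i<..}"])
      (auto intro: renewal_past_measurable sq_integrable_noise sq_integrable_renewal)
  have g_eq: "g i = (var + lam\<^sup>2) * expectation (\<lambda>\<omega>. (noise_renewal b k i \<omega>)\<^sup>2)" for i
    unfolding g_def G_def expectation_noise_square[of "k - int i", symmetric]
    by (rule expectation_noise_history_square[where f = "\<lambda>x. x" and B = "{k - int i<..}"])
      (auto intro: renewal_past_measurable sq_integrable_noise sq_integrable_renewal)
  have "summable (\<lambda>n. expectation (\<lambda>\<omega>. (noise_renewal b k n \<omega>)\<^sup>2))"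
    by (rule summable_renewal_second_moment[OF lam_pos var_pos
          summable_Suc_iff[THEN iffD2, OF arch_z_square_summable] Omega_less_1])
  then have "summable g" unfolding g_eq by (rule summable_mult)
  then have "(\<lambda>i. sqrt (g i)) \<longlonglongrightarrow> sqrt 0"
    by (intro tendsto_real_sqrt summable_LIMSEQ_zero)
  then have g_lim: "(\<lambda>i. sqrt (g i) * sqrt square_mean) \<longlonglongrightarrow> 0"
    by (auto intro: tendsto_mult_left_zero)
  have T0: "T n \<ge> 0" for n
    unfolding T_def using summable_ignore_initial_segment[OF b_summable, of n] b_nonneg
    by (intro suminf_nonneg) (auto simp: add_ac)
  have V_index: "V i N = (\<lambda>\<omega>. \<Sum>j. b (Suc (N - i) + j) * X (k - int (Suc N) - int j) \<omega>)"
    if "i < Suc N" for i N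
  proof -
    have "Suc N - i = Suc (N - i)" using that by simp
    then show ?thesis by (intro ext) (simp only: V_def)
  qed
  have Vsq: "sq_integrable M (V i N)" if "i < Suc N" for i N
    unfolding V_index[OF that] by (rule weighted_tail_sq_integrable)
  have V2: "sqrt (expectation (\<lambda>\<omega>. (V i N \<omega>)\<^sup>2)) \<le> T (Suc N - Suc i) * sqrt square_mean" if "i < Suc N" for i N
  proof -
    have "expectation (\<lambda>\<omega>. (V i N \<omega>)\<^sup>2) \<le> (T (N - i))\<^sup>2 * square_mean"
      unfolding V_index[OF that] T_def by (rule weighted_tail_sq_integrable)
    then have "sqrt (expectation (\<lambda>\<omega>. (V i N \<omega>)\<^sup>2)) \<le> sqrt ((T (N - i))\<^sup>2 * square_mean)"
      by (rule real_sqrt_le_mono)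
    then show ?thesis using T0[of "N - i"] by (simp add: real_sqrt_mult)
  qed
  have R_int: "integrable M (R N)" for N
    unfolding R_def by (intro Bochner_Integration.integrable_sum sq_integrable_mult Gsq Vsq) auto
  have R_le: "expectation (\<lambda>\<omega>. \<bar>R N \<omega>\<bar>) \<le> (\<Sum>i<Suc N. sqrt (g i) * sqrt square_mean * T (Suc N - Suc i))" for N
  proof -
    have int: "integrable M (\<lambda>\<omega>. \<bar>G i \<omega> * V i N \<omega>\<bar>)" if "i < Suc N" for i
      using sq_integrable_mult[OF Gsq Vsq[OF that]] by (rule integrable_abs)
    have "expectation (\<lambda>\<omega>. \<bar>R N \<omega>\<bar>) \<le> expectation (\<lambda>\<omega>. \<Sum>i<Suc N. \<bar>G i \<omega> * V i N \<omega>\<bar>)"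
    proof (rule integral_mono)
      show "integrable M (\<lambda>\<omega>. \<bar>R N \<omega>\<bar>)" by (rule integrable_abs[OF R_int])
      show "integrable M (\<lambda>\<omega>. \<Sum>i<Suc N. \<bar>G i \<omega> * V i N \<omega>\<bar>)"
        by (intro Bochner_Integration.integrable_sum int) auto
      show "\<bar>R N \<omega>\<bar> \<le> (\<Sum>i<Suc N. \<bar>G i \<omega> * V i N \<omega>\<bar>)" for \<omega>
        unfolding R_def by (rule sum_abs)
    qed
    also have "\<dots> = (\<Sum>i<Suc N. expectation (\<lambda>\<omega>. \<bar>G i \<omega> * V i N \<omega>\<bar>))"
      by (intro Bochner_Integration.integral_sum int) auto
    also have "\<dots> \<le> (\<Sum>i<Suc N. sqrt (g i) * (T (Suc N - Suc i) * sqrt square_mean))"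
    proof (rule sum_mono)
      fix i assume "i \<in> {..<Suc N}"
      then have i: "i < Suc N" by simp
      have "expectation (\<lambda>\<omega>. \<bar>G i \<omega> * V i N \<omega>\<bar>) \<le> sqrt (g i) * sqrt (expectation (\<lambda>\<omega>. (V i N \<omega>)\<^sup>2))"
        unfolding g_def by (rule integral_abs_mult_le[OF Gsq Vsq[OF i]])
      also have "\<dots> \<le> sqrt (g i) * (T (Suc N - Suc i) * sqrt square_mean)"
        by (intro mult_left_mono V2[OF i]) (simp add: g_def)
      finally show "expectation (\<lambda>\<omega>. \<bar>G i \<omega> * V i N \<omega>\<bar>) \<le> sqrt (g i) * (T (Suc N - Suc i) * sqrt square_mean)" .
    qed
    finally show ?thesis by (simp only: mult_ac)
  qed
  have "(\<lambda>N. \<Sum>i<N. sqrt (g i) * sqrt square_mean * T (N - Suc i)) \<longlonglongrightarrow> 0"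
    using g_lim b_tails_summable T0 unfolding T_def by (intro convolution_vanishing_summable)
  then have up: "(\<lambda>N. \<Sum>i<Suc N. sqrt (g i) * sqrt square_mean * T (Suc N - Suc i)) \<longlonglongrightarrow> 0"
    by (rule LIMSEQ_Suc)
  have "(\<lambda>N. expectation (\<lambda>\<omega>. norm (R N \<omega>))) \<longlonglongrightarrow> 0"
  proof (rule tendsto_sandwich[OF _ _ tendsto_const up])
    show "\<forall>\<^sub>F N in sequentially. 0 \<le> expectation (\<lambda>\<omega>. norm (R N \<omega>))" by simp
    show "\<forall>\<^sub>F N in sequentially. expectation (\<lambda>\<omega>. norm (R N \<omega>))
        \<le> (\<Sum>i<Suc N. sqrt (g i) * sqrt square_mean * T (Suc N - Suc i))"
      using R_le by (intro always_eventually allI) (simp only: real_norm_def)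
  qed
  from tendsto_L1_AE_subseq[OF R_int this]
  obtain h :: "nat \<Rightarrow> nat" where h: "strict_mono h" and
    R_lim: "AE \<omega> in M. (\<lambda>n. R (h n) \<omega>) \<longlonglongrightarrow> 0" by blast
  have noise_nn: "AE \<omega> in M. \<forall>k. \<xi> k \<omega> \<ge> 0"
    using noise_nonneg by (simp add: AE_all_countable)
  show ?thesis
    using R_lim noise_nn solution_AE
  proof eventually_elim
    case (elim \<omega>)
    have G0: "G i \<omega> \<ge> 0" for i
      unfolding G_def using elim(2) b_nonneg by (intro mult_nonneg_nonneg renewal_nonneg) auto
    have exp: "X k \<omega> = a * (\<Sum>i<Suc N. G i \<omega>) + R N \<omega>" for N
    proof -
      have "X k \<omega> = (\<Sum>i<Suc N. \<xi> (k - int i) \<omega> * noise_renewal b k i \<omega> *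
          (a + (\<Sum>j. b (Suc N - i + j) * X (k - int (Suc N) - int j) \<omega>)))"
      proof (rule renewal_expansion[where y = "\<lambda>i. X i \<omega>" and \<alpha> = "\<lambda>_. a"])
        fix l
        show "summable (\<lambda>j. b (Suc j) * X (l - int (Suc j)) \<omega>)" using elim(3) by blast
        have "X l \<omega> = vol l \<omega> * \<xi> l \<omega>" using elim(3) by blast
        also have "\<dots> = \<xi> l \<omega> * (a + (\<Sum>j. b (Suc j) * X (l - int (Suc j)) \<omega>))"
          by (simp only: volatility_def mult.commute)
        finally show "X l \<omega> = \<xi> l \<omega> * (a + (\<Sum>j. b (Suc j) * X (l - int (Suc j)) \<omega>))" .
      qed
      also have "\<dots> = (\<Sum>i<Suc N. a * G i \<omega> + G i \<omega> * V i N \<omega>)"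
        unfolding G_def V_def by (intro sum.cong refl) (simp add: algebra_simps)
      finally show ?thesis unfolding R_def by (simp only: sum.distrib sum_distrib_left)
    qed
    have lim: "(\<lambda>n. \<Sum>i<Suc (h n). G i \<omega>) \<longlonglongrightarrow> X k \<omega> / a"
    proof -
      have "(\<lambda>n. (X k \<omega> - R (h n) \<omega>) / a) \<longlonglongrightarrow> (X k \<omega> - 0) / a"
        using a_pos by (intro tendsto_intros elim(1)) auto
      moreover have "(X k \<omega> - R (h n) \<omega>) / a = (\<Sum>i<Suc (h n). G i \<omega>)" for n
        using exp[of "h n"] a_pos by (simp add: field_simps del: sum.lessThan_Suc)
      ultimately show ?thesis by simp
    qed
    then have "Bseq (\<lambda>n. \<Sum>i<Suc (h n). G i \<omega>)"
      by (intro convergent_imp_Bseq) (auto simp: convergent_def)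
    then obtain C where C: "\<And>n. norm (\<Sum>i<Suc (h n). G i \<omega>) \<le> C"
      unfolding Bseq_def by blast
    have "summable (\<lambda>i. G i \<omega>)"
    proof (rule bounded_imp_summable[OF G0])
      fix n
      have "n \<le> h n" using h by (rule seq_suble)
      then have "(\<Sum>i\<le>n. G i \<omega>) \<le> (\<Sum>i<Suc (h n). G i \<omega>)"
        using G0 by (intro sum_mono2) auto
      also have "\<dots> \<le> C" using C[of n] by (simp only: real_norm_def abs_le_iff)
      finally show "(\<Sum>i\<le>n. G i \<omega>) \<le> C" .
    qed
    then have "(\<lambda>n. \<Sum>i<n. G i \<omega>) \<longlonglongrightarrow> (\<Sum>i. G i \<omega>)" by (rule summable_LIMSEQ)
    from LIMSEQ_subseq_LIMSEQ[OF LIMSEQ_Suc[OF this] h]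
    have "(\<lambda>n. \<Sum>i<Suc (h n). G i \<omega>) \<longlonglongrightarrow> (\<Sum>i. G i \<omega>)" by (simp only: comp_def)
    with lim have "X k \<omega> / a = (\<Sum>i. G i \<omega>)" by (rule LIMSEQ_unique)
    then show ?case using a_pos by (simp add: causal_def G_def field_simps)
  qed
qed

lemma vol_history_measurable:
  assumes "{..<k} \<subseteq> B" shows "volatility a b causal k \<in> borel_measurable (history B)"
proof -
  have "causal (k - int (Suc j)) \<in> borel_measurable (history B)" for j
    using assms by (intro causal_history_measurable) auto
  then show ?thesis unfolding volatility_def
    by (intro borel_measurable_add borel_measurable_times borel_measurable_const borel_measurable_suminf)
qed

lemma vol_AE_causal: "AE \<omega> in M. vol k \<omega> = volatility a b causal k \<omega>"
proof -
  have "AE \<omega> in M. \<forall>k. X k \<omega> = causal k \<omega>"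
    using solution_AE_causal by (simp add: AE_all_countable)
  then show ?thesis by eventually_elim (simp add: volatility_def)
qed

section \<open>The autocovariance function\<close>

text \<open>
  The process \<open>\<nu>\<close>: the part of \<open>X k\<close> that cannot be predicted from the past.
\<close>

definition innov :: "int \<Rightarrow> 'w \<Rightarrow> real" where
  "innov k \<omega> = X k \<omega> - lam * vol k \<omega>"

lemma sq_integrable_innov: "sq_integrable M (innov k)"
  unfolding innov_def by (intro sq_integrable_diff sq_integrable_scale sq_integrable_X sq_integrable_vol)

lemma innov_AE: "AE \<omega> in M. innov k \<omega> = (\<xi> k \<omega> - lam) * volatility a b causal k \<omega>"
  using solution_AE vol_AE_causal[of k]
  by eventually_elim (simp add: innov_def algebra_simps)

text \<open>
  By causality the volatility at time \<open>k\<close> depends on the noise before \<open>k\<close> only, so the factor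
  \<open>\<xi> k - lam\<close> of \<open>innov k\<close> is independent of everything else in the product.
\<close>

lemma innov_orthogonal_past:
  assumes W: "sq_integrable M W" and W': "W' \<in> borel_measurable (history {..<k})"
    and AE: "AE \<omega> in M. W \<omega> = W' \<omega>"
  shows "expectation (\<lambda>\<omega>. innov k \<omega> * W \<omega>) = 0"
proof -
  have int: "integrable M (\<lambda>\<omega>. vol k \<omega> * W \<omega>)"
    by (rule sq_integrable_mult[OF sq_integrable_vol W])
  have meas: "(\<lambda>\<omega>. volatility a b causal k \<omega> * W' \<omega>) \<in> borel_measurable (history {..<k})"
    by (intro borel_measurable_times vol_history_measurable W') auto
  have "AE \<omega> in M. vol k \<omega> * W \<omega> = volatility a b causal k \<omega> * W' \<omega>"
    using vol_AE_causal[of k] AE by eventually_elim simp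
  then have int': "integrable M (\<lambda>\<omega>. volatility a b causal k \<omega> * W' \<omega>)"
    using int history_measurable_global[OF meas]
    by (subst integrable_cong_AE[symmetric]) auto
  have "expectation (\<lambda>\<omega>. innov k \<omega> * W \<omega>) =
      expectation (\<lambda>\<omega>. (\<xi> k \<omega> - lam) * (volatility a b causal k \<omega> * W' \<omega>))"
  proof (rule integral_cong_AE)
    show "AE \<omega> in M. innov k \<omega> * W \<omega> = (\<xi> k \<omega> - lam) * (volatility a b causal k \<omega> * W' \<omega>)"
      using innov_AE[of k] AE by eventually_elim simp
    show "(\<lambda>\<omega>. innov k \<omega> * W \<omega>) \<in> borel_measurable M"
      using sq_integrable_innov[of k] W by (auto simp: sq_integrable_def)
    show "(\<lambda>\<omega>. (\<xi> k \<omega> - lam) * (volatility a b causal k \<omega> * W' \<omega>)) \<in> borel_measurable M"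
      using history_measurable_global[OF meas] by measurable
  qed
  also have "\<dots> = 0"
    by (rule centred_noise_orthogonal_history[OF _ meas int']) simp
  finally show ?thesis .
qed

lemma innov_orthogonal_X: "j < k \<Longrightarrow> expectation (\<lambda>\<omega>. innov k \<omega> * X j \<omega>) = 0"
  by (rule innov_orthogonal_past[OF sq_integrable_X causal_history_measurable solution_AE_causal]) auto

lemma innov_orthogonal_vol: "expectation (\<lambda>\<omega>. innov k \<omega> * vol k \<omega>) = 0"
  by (rule innov_orthogonal_past[OF sq_integrable_vol vol_history_measurable vol_AE_causal]) auto

lemma innov_mean: "expectation (innov k) = 0"
  using innov_orthogonal_past[of "\<lambda>_. 1" "\<lambda>_. 1" k] by (simp add: sq_integrable_const)

lemma innov_orthogonal_innov:
  assumes "j < k" shows "expectation (\<lambda>\<omega>. innov k \<omega> * innov j \<omega>) = 0"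
proof (rule innov_orthogonal_past[OF sq_integrable_innov _ innov_AE])
  have "\<xi> j \<in> borel_measurable (history {..<k})" "volatility a b causal j \<in> borel_measurable (history {..<k})"
    using assms by (auto intro!: noise_history_measurable vol_history_measurable)
  then show "(\<lambda>\<omega>. (\<xi> j \<omega> - lam) * volatility a b causal j \<omega>) \<in> borel_measurable (history {..<k})"
    by (intro borel_measurable_times borel_measurable_diff borel_measurable_const)
qed

text \<open>
  Termwise integration of the series that defines the volatility; the uniform bound on the second
  moments of \<open>X\<close> makes it absolutely convergent.
\<close>

lemma expectation_vol_mult:
  assumes W: "sq_integrable M W"
  shows "(\<lambda>j. b (Suc j) * expectation (\<lambda>\<omega>. X (k - int (Suc j)) \<omega> * W \<omega>)) sums
    (expectation (\<lambda>\<omega>. vol k \<omega> * W \<omega>) - a * expectation W)"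
proof -
  define f where "f j \<omega> = b (Suc j) * (X (k - int (Suc j)) \<omega> * W \<omega>)" for j \<omega>
  have int: "integrable M (f j)" for j
    unfolding f_def by (intro integrable_mult_right sq_integrable_mult sq_integrable_X W)
  define K where "K = sqrt square_mean * sqrt (expectation (\<lambda>\<omega>. (W \<omega>)\<^sup>2))"
  have "summable (\<lambda>j. expectation (\<lambda>\<omega>. \<bar>f j \<omega>\<bar>))"
  proof (rule summable_comparison_test')
    show "summable (\<lambda>j. b (Suc j) * K)" using b_summable by (rule summable_mult2)
    fix j
    have "expectation (\<lambda>\<omega>. \<bar>X (k - int (Suc j)) \<omega> * W \<omega>\<bar>) \<le> K"
      using integral_abs_mult_le[OF sq_integrable_X W] unfolding expectation_X_square K_def .
    then have "b (Suc j) * expectation (\<lambda>\<omega>. \<bar>X (k - int (Suc j)) \<omega> * W \<omega>\<bar>) \<le> b (Suc j) * K"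
      using b_nonneg by (intro mult_left_mono) auto
    moreover have "expectation (\<lambda>\<omega>. \<bar>f j \<omega>\<bar>) = b (Suc j) * expectation (\<lambda>\<omega>. \<bar>X (k - int (Suc j)) \<omega> * W \<omega>\<bar>)"
      unfolding f_def using b_nonneg[of "Suc j"] by (simp add: abs_mult)
    moreover have "0 \<le> expectation (\<lambda>\<omega>. \<bar>f j \<omega>\<bar>)" by simp
    ultimately show "norm (expectation (\<lambda>\<omega>. \<bar>f j \<omega>\<bar>)) \<le> b (Suc j) * K"
      by (simp only: real_norm_def abs_of_nonneg)
  qed
  note series = L1_series[OF int this]
  have "AE \<omega> in M. vol k \<omega> * W \<omega> = a * W \<omega> + (\<Sum>j. f j \<omega>)"
    using solution_AE
  proof eventually_elim
    case (elim \<omega>)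
    then have "summable (\<lambda>j. b (Suc j) * X (k - int (Suc j)) \<omega>)" by blast
    from suminf_mult2[OF this, of "W \<omega>"]
    have "(\<Sum>j. b (Suc j) * X (k - int (Suc j)) \<omega> * W \<omega>) = (\<Sum>j. b (Suc j) * X (k - int (Suc j)) \<omega>) * W \<omega>"
      by (rule sym)
    then show ?case by (simp add: volatility_def f_def distrib_right mult.assoc)
  qed
  then have "expectation (\<lambda>\<omega>. vol k \<omega> * W \<omega>) = expectation (\<lambda>\<omega>. a * W \<omega> + (\<Sum>j. f j \<omega>))"
    using series(2) sq_integrable_vol[of k] W
    by (intro integral_cong_AE) (auto simp: sq_integrable_def)
  also have "\<dots> = a * expectation W + expectation (\<lambda>\<omega>. \<Sum>j. f j \<omega>)"
    using series(2) sq_integrable_integrable[OF W] by simp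
  finally have "(\<lambda>j. expectation (f j)) sums (expectation (\<lambda>\<omega>. vol k \<omega> * W \<omega>) - a * expectation W)"
    using series(3) by simp
  then show ?thesis by (simp add: f_def[abs_def])
qed

end

context arch_process
begin

abbreviation total_weight :: real where "total_weight \<equiv> (\<Sum>j. b (Suc j))"

abbreviation innov_square :: real where "innov_square \<equiv> expectation (\<lambda>\<omega>. (innov 0 \<omega>)\<^sup>2)"

lemma X_innov: "X k \<omega> = innov k \<omega> + lam * vol k \<omega>"
  by (simp add: innov_def)

lemma mean_vol: "mean = lam * expectation (vol k)"
proof -
  have "expectation (X k) = expectation (innov k) + lam * expectation (vol k)"
    unfolding X_innov[of k] using sq_integrable_integrable[OF sq_integrable_innov[of k]]
      sq_integrable_integrable[OF sq_integrable_vol[of k]] by simp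
  then show ?thesis by (simp add: expectation_X innov_mean)
qed

lemma expectation_vol: "expectation (vol k) = a + total_weight * mean"
proof -
  have "(\<lambda>j. b (Suc j) * mean) sums (expectation (vol k) - a)"
    using expectation_vol_mult[OF sq_integrable_const[of 1], of k] by (simp add: expectation_X prob_space)
  moreover have "(\<lambda>j. b (Suc j) * mean) sums (total_weight * mean)"
    by (intro sums_mult2 summable_sums b_summable)
  ultimately show ?thesis using sums_unique2 by fastforce
qed

lemma vol_pos: "expectation (vol k) > 0"
proof -
  have "expectation (vol k) * (1 - lam * total_weight) = a"
    using expectation_vol[of k] mean_vol[of k] by (simp add: algebra_simps)
  then show ?thesis using a_pos subcritical by (metis diff_gt_0_iff_gt zero_less_mult_pos2)
qed

text \<open>
  By independence \<open>innov_square = var * E[vol(0)\<^sup>2]\<close>, and the volatility has positive mean.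
\<close>

lemma innov_square_pos: "innov_square > 0"
proof -
  define v where "v = volatility a b causal 0"
  have meas: "v \<in> borel_measurable (history {..<0})" unfolding v_def by (rule vol_history_measurable) simp
  have AE: "AE \<omega> in M. vol 0 \<omega> = v \<omega>" unfolding v_def by (rule vol_AE_causal)
  have [measurable]: "v \<in> borel_measurable M" "vol 0 \<in> borel_measurable M"
    using history_measurable_global[OF meas] sq_integrable_vol[of 0] by (auto simp: sq_integrable_def)
  have AE2: "AE \<omega> in M. (vol 0 \<omega>)\<^sup>2 = (v \<omega>)\<^sup>2" using AE by eventually_elim simp
  have "integrable M (\<lambda>\<omega>. (v \<omega>)\<^sup>2)"
    using sq_integrable_vol[of 0] AE2 by (subst integrable_cong_AE[symmetric]) (auto simp: sq_integrable_def)
  then have v: "sq_integrable M v" by (simp add: sq_integrable_def)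
  have "0 < expectation (vol 0)" by (rule vol_pos)
  also have "\<dots> \<le> expectation (\<lambda>\<omega>. \<bar>vol 0 \<omega> * 1\<bar>)"
    using sq_integrable_integrable[OF sq_integrable_vol[of 0]] by (intro integral_mono) auto
  also have "\<dots> \<le> sqrt (expectation (\<lambda>\<omega>. (vol 0 \<omega>)\<^sup>2)) * sqrt (expectation (\<lambda>\<omega>. 1\<^sup>2))"
    by (rule integral_abs_mult_le[OF sq_integrable_vol sq_integrable_const])
  finally have "0 < expectation (\<lambda>\<omega>. (vol 0 \<omega>)\<^sup>2)" by (simp add: prob_space)
  also have "\<dots> = expectation (\<lambda>\<omega>. (v \<omega>)\<^sup>2)" using AE2 by (intro integral_cong_AE) auto
  finally have pos: "0 < expectation (\<lambda>\<omega>. (v \<omega>)\<^sup>2)" .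
  have "innov_square = expectation (\<lambda>\<omega>. ((\<xi> 0 \<omega> - lam) * v \<omega>)\<^sup>2)"
  proof (rule integral_cong_AE)
    show "AE \<omega> in M. (innov 0 \<omega>)\<^sup>2 = ((\<xi> 0 \<omega> - lam) * v \<omega>)\<^sup>2"
      using innov_AE[of 0] unfolding v_def by eventually_elim simp
    show "(\<lambda>\<omega>. (innov 0 \<omega>)\<^sup>2) \<in> borel_measurable M"
      using sq_integrable_innov[of 0] by (auto simp: sq_integrable_def)
  qed simp
  also have "\<dots> = expectation (\<lambda>\<omega>. (\<xi> 0 \<omega> - lam)\<^sup>2) * expectation (\<lambda>\<omega>. (v \<omega>)\<^sup>2)"
    by (rule expectation_noise_history_square[where f = "\<lambda>x. x - lam" and B = "{..<0}", OF _ _ meas _ v])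
      (auto intro: sq_integrable_centred_noise)
  also have "\<dots> > 0" using var_pos pos by (simp add: expectation_centred_noise_square)
  finally show ?thesis .
qed

definition cross :: "int \<Rightarrow> real" where
  "cross k = expectation (\<lambda>\<omega>. innov 0 \<omega> * X k \<omega>)"

lemma expectation_mult_X:
  assumes W: "sq_integrable M W"
  shows "expectation (\<lambda>\<omega>. W \<omega> * X k \<omega>)
    = expectation (\<lambda>\<omega>. W \<omega> * innov k \<omega>) + lam * expectation (\<lambda>\<omega>. vol k \<omega> * W \<omega>)"
proof -
  have "expectation (\<lambda>\<omega>. W \<omega> * X k \<omega>) = expectation (\<lambda>\<omega>. W \<omega> * innov k \<omega> + lam * (vol k \<omega> * W \<omega>))"
    by (intro Bochner_Integration.integral_cong refl) (simp add: X_innov[of k] algebra_simps)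
  then show ?thesis
    using sq_integrable_mult[OF W sq_integrable_innov] sq_integrable_mult[OF sq_integrable_vol W] by simp
qed

text \<open>
  Replacing \<open>X(n)\<close> by \<open>\<nu>(n) + lam * vol(n)\<close> and using that \<open>\<nu>(0)\<close> is orthogonal to \<open>\<nu>(n)\<close> and to
  \<open>X\<close> at negative times leaves, for \<open>n > 0\<close>, the recursion of \<open>arch_z\<close>.
\<close>

lemma cross_eq: "cross (int n) = innov_square * arch_z lam b n"
proof (induction n rule: less_induct)
  case (less n)
  show ?case
  proof (cases n)
    case 0
    have "expectation (\<lambda>\<omega>. vol 0 \<omega> * innov 0 \<omega>) = 0"
      using innov_orthogonal_vol[of 0] by (simp add: mult.commute)
    then show ?thesis
      using expectation_mult_X[OF sq_integrable_innov, of 0 0] 0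
      by (simp add: cross_def power2_eq_square)
  next
    case (Suc m)
    have orth: "expectation (\<lambda>\<omega>. innov 0 \<omega> * innov (int n) \<omega>) = 0"
      using innov_orthogonal_innov[of 0 "int n"] Suc by (simp add: mult.commute)
    have cross': "expectation (\<lambda>\<omega>. X k \<omega> * innov 0 \<omega>) = cross k" for k
      by (simp add: cross_def mult.commute)
    have neg: "cross k = 0" if "k < 0" for k
      using innov_orthogonal_X[OF that] by (simp add: cross_def)
    have "(\<lambda>j. b (Suc j) * cross (int n - int (Suc j))) sums expectation (\<lambda>\<omega>. vol (int n) \<omega> * innov 0 \<omega>)"
      using expectation_vol_mult[OF sq_integrable_innov[of 0], of "int n"] unfolding cross' by (simp add: innov_mean)
    moreover have "(\<lambda>j. b (Suc j) * cross (int n - int (Suc j))) sums (\<Sum>j\<in>{..m}. b (Suc j) * cross (int n - int (Suc j)))"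
      using neg Suc by (intro sums_finite) auto
    ultimately have "expectation (\<lambda>\<omega>. vol (int n) \<omega> * innov 0 \<omega>) = (\<Sum>j\<le>m. b (Suc j) * cross (int n - int (Suc j)))"
      by (rule sums_unique2)
    also have "\<dots> = (\<Sum>j = 0..m. b (Suc m - j) * (innov_square * arch_z lam b j))"
    proof (rule sum.reindex_bij_witness[where i = "\<lambda>j. m - j" and j = "\<lambda>j. m - j"])
      fix j assume j: "j \<in> {..m}"
      have eq: "int n - int (Suc j) = int (m - j)" using j Suc by auto
      have "m - j < n" using Suc by simp
      then have "cross (int n - int (Suc j)) = innov_square * arch_z lam b (m - j)"
        unfolding eq by (rule less.IH)
      moreover have "Suc m - (m - j) = Suc j" using j by simp
      ultimately show "b (Suc m - (m - j)) * (innov_square * arch_z lam b (m - j)) = b (Suc j) * cross (int n - int (Suc j))"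
        by (simp only:)
    qed auto
    finally show ?thesis
      using expectation_mult_X[OF sq_integrable_innov, of 0 "int n"] orth Suc
      by (simp add: cross_def sum_distrib_left mult_ac)
  qed
qed

lemma autocovariance_X: "autocovariance M X k = expectation (\<lambda>\<omega>. X 0 \<omega> * X k \<omega>) - mean\<^sup>2"
  by (simp add: autocovariance_def covariance_X)

lemma autocovariance_bounded: "\<bar>autocovariance M X k\<bar> \<le> square_mean + mean\<^sup>2"
proof -
  have "\<bar>expectation (\<lambda>\<omega>. X 0 \<omega> * X k \<omega>)\<bar> \<le> expectation (\<lambda>\<omega>. \<bar>X 0 \<omega> * X k \<omega>\<bar>)"
    by (rule integral_abs_bound)
  also have "\<dots> \<le> square_mean"
    using integral_abs_mult_le[OF sq_integrable_X[of 0] sq_integrable_X[of k]] square_mean_nonneg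
    by (simp add: expectation_X_square)
  finally show ?thesis unfolding autocovariance_X by (smt (verit) zero_le_power2)
qed

text \<open>
  Obtained by replacing the factor at the earlier time \<open>0\<close>, rather than the later one, by
  \<open>\<nu>(0) + lam * vol(0)\<close>. The recursion therefore runs towards larger lags, for which \<open>cross\<close> is
  already known.
\<close>

lemma autocovariance_recursion:
  "(\<lambda>j. b (Suc j) * autocovariance M X (n + int (Suc j))) sums ((autocovariance M X n - cross n) / lam)"
proof -
  have X2: "expectation (\<lambda>\<omega>. X (0 - int (Suc j)) \<omega> * X n \<omega>) = autocovariance M X (n + int (Suc j)) + mean\<^sup>2" for j
    using covariance_shift[of "- int (Suc j)" "n + int (Suc j)"] covariance_X[of "- int (Suc j)" n] by simp
  have "(\<lambda>j. b (Suc j) * (autocovariance M X (n + int (Suc j)) + mean\<^sup>2)) sums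
      (expectation (\<lambda>\<omega>. vol 0 \<omega> * X n \<omega>) - a * mean)"
    using expectation_vol_mult[OF sq_integrable_X[of n], of 0] unfolding X2 by (simp add: expectation_X)
  from sums_diff[OF this sums_mult2[OF summable_sums[OF b_summable], of "mean\<^sup>2"]]
  have sums: "(\<lambda>j. b (Suc j) * autocovariance M X (n + int (Suc j))) sums
      (expectation (\<lambda>\<omega>. vol 0 \<omega> * X n \<omega>) - a * mean - total_weight * mean\<^sup>2)"
    by (simp add: distrib_left)
  have "expectation (\<lambda>\<omega>. X n \<omega> * X 0 \<omega>)
      = expectation (\<lambda>\<omega>. X n \<omega> * innov 0 \<omega>) + lam * expectation (\<lambda>\<omega>. vol 0 \<omega> * X n \<omega>)"
    by (rule expectation_mult_X[OF sq_integrable_X])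
  then have "autocovariance M X n + mean\<^sup>2 = cross n + lam * expectation (\<lambda>\<omega>. vol 0 \<omega> * X n \<omega>)"
    unfolding autocovariance_X cross_def by (simp add: mult.commute)
  moreover have "mean\<^sup>2 = lam * (a * mean + total_weight * mean\<^sup>2)"
    using mean_vol[of 0] unfolding expectation_vol power2_eq_square by algebra
  ultimately have "autocovariance M X n - cross n
      = lam * (expectation (\<lambda>\<omega>. vol 0 \<omega> * X n \<omega>) - a * mean - total_weight * mean\<^sup>2)"
    by (simp add: algebra_simps)
  then show ?thesis using sums lam_pos by simp
qed

text \<open>
  Reversing the sign of the lag brings the recursion into the form required by the expansion lemma,
  with \<open>lam\<close> as constant noise. The remainder vanishes because the autocovariances are bounded.
\<close>

lemma autocovariance_sums:
  "(\<lambda>i. arch_z lam b i * arch_z lam b (n + i)) sums (autocovariance M X (int n) / innov_square)"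
proof -
  define \<rho> where "\<rho> = autocovariance M X"
  define z where "z = arch_z lam b"
  define K where "K = square_mean + mean\<^sup>2"
  define T where "T n = (\<Sum>j. b (Suc n + j))" for n
  have sm: "summable (\<lambda>j. b (Suc n + j))" for n
    using summable_ignore_initial_segment[OF b_summable, of n] by (simp add: add_ac)
  have T0: "T n \<ge> 0" for n unfolding T_def using b_nonneg by (intro suminf_nonneg sm) auto
  define R where "R N = (\<Sum>i<Suc N. lam * z i * (\<Sum>j. b (Suc N - i + j) * \<rho> (int n + int (Suc N) + int j)))" for N
  have exp: "\<rho> (int n) = (\<Sum>i<Suc N. z i * cross (int n + int i)) + R N" for N
  proof -
    have rec: "(\<lambda>j. b (Suc j) * \<rho> (- (k - int (Suc j)))) sums ((\<rho> (- k) - cross (- k)) / lam)" for k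
      using autocovariance_recursion[of "- k"] by (simp add: \<rho>_def)
    have "\<rho> (- (- int n)) = (\<Sum>i<Suc N. lam * renewal b (\<lambda>_. lam) (- int n) i *
        (cross (- (- int n - int i)) / lam + (\<Sum>j. b (Suc N - i + j) * \<rho> (- (- int n - int (Suc N) - int j)))))"
    proof (rule renewal_expansion[where y = "\<lambda>k. \<rho> (- k)" and \<alpha> = "\<lambda>k. cross (- k) / lam"])
      show "summable (\<lambda>j. b (Suc j) * \<rho> (- (k - int (Suc j))))" for k
        using rec by (rule sums_summable)
      show "\<rho> (- k) = lam * (cross (- k) / lam + (\<Sum>j. b (Suc j) * \<rho> (- (k - int (Suc j)))))" for k
        using sums_unique[OF rec[of k]] lam_pos by (simp add: field_simps)
    qed
    also have "\<dots> = (\<Sum>i<Suc N. lam * z i * (cross (int n + int i) / lam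
        + (\<Sum>j. b (Suc N - i + j) * \<rho> (int n + int (Suc N) + int j))))"
      unfolding renewal_const z_def[symmetric] diff_diff_eq minus_diff_eq minus_minus
      by (simp only: diff_minus_eq_add add_ac)
    also have "\<dots> = (\<Sum>i<Suc N. z i * cross (int n + int i) +
        lam * z i * (\<Sum>j. b (Suc N - i + j) * \<rho> (int n + int (Suc N) + int j)))"
      using lam_pos by (intro sum.cong refl) (simp add: distrib_left)
    finally show ?thesis unfolding R_def by (simp only: sum.distrib minus_minus)
  qed
  have R_le: "\<bar>R N\<bar> \<le> (\<Sum>i<Suc N. lam * z i * K * T (Suc N - Suc i))" for N
  proof -
    have "\<bar>R N\<bar> \<le> (\<Sum>i<Suc N. \<bar>lam * z i * (\<Sum>j. b (Suc N - i + j) * \<rho> (int n + int (Suc N) + int j))\<bar>)"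
      unfolding R_def by (rule sum_abs)
    also have "\<dots> \<le> (\<Sum>i<Suc N. lam * z i * (T (Suc N - Suc i) * K))"
    proof (rule sum_mono)
      fix i assume "i \<in> {..<Suc N}"
      then have i: "Suc N - i = Suc (Suc N - Suc i)" by auto
      define f where "f j = b (Suc N - i + j) * \<rho> (int n + int (Suc N) + int j)" for j
      have f_le: "norm (f j) \<le> b (Suc N - i + j) * K" for j
        unfolding f_def real_norm_def abs_mult using autocovariance_bounded b_nonneg[of "Suc N - i + j"] i
        by (simp add: \<rho>_def K_def mult_left_mono)
      have smK: "summable (\<lambda>j. b (Suc N - i + j) * K)" unfolding i by (rule summable_mult2[OF sm])
      have "norm (\<Sum>j. f j) \<le> (\<Sum>j. b (Suc N - i + j) * K)"
        using f_le smK by (rule norm_suminf_le)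
      also have "\<dots> = T (Suc N - Suc i) * K"
        unfolding i T_def by (rule suminf_mult2[OF sm, symmetric])
      finally have "\<bar>\<Sum>j. f j\<bar> \<le> T (Suc N - Suc i) * K" by simp
      moreover have "lam * z i \<ge> 0" using lam_pos arch_z_noise_mean_nonneg by (simp add: z_def)
      ultimately show "\<bar>lam * z i * (\<Sum>j. b (Suc N - i + j) * \<rho> (int n + int (Suc N) + int j))\<bar>
          \<le> lam * z i * (T (Suc N - Suc i) * K)"
        unfolding f_def by (simp only: abs_mult[of "lam * z i"] abs_of_nonneg mult_left_mono)
    qed
    finally show ?thesis by (simp only: mult_ac)
  qed
  have "(\<lambda>i. lam * z i * K) \<longlonglongrightarrow> lam * 0 * K"
    unfolding z_def by (intro tendsto_intros summable_LIMSEQ_zero arch_z_summable)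
  then have "(\<lambda>N. \<Sum>i<N. lam * z i * K * T (N - Suc i)) \<longlonglongrightarrow> 0"
    using b_tails_summable T0 unfolding T_def by (intro convolution_vanishing_summable) auto
  then have "(\<lambda>N. \<Sum>i<Suc N. lam * z i * K * T (Suc N - Suc i)) \<longlonglongrightarrow> 0" by (rule LIMSEQ_Suc)
  then have "R \<longlonglongrightarrow> 0"
    by (rule Lim_null_comparison[rotated]) (use R_le in \<open>intro always_eventually allI, simp only: real_norm_def\<close>)
  then have "(\<lambda>N. \<rho> (int n) - R N) \<longlonglongrightarrow> \<rho> (int n) - 0" by (intro tendsto_intros)
  moreover have "\<rho> (int n) - R N = (\<Sum>i<Suc N. z i * cross (int n + int i))" for N
    using exp[of N] by simp
  ultimately have "(\<lambda>N. \<Sum>i<Suc N. z i * cross (int n + int i)) \<longlonglongrightarrow> \<rho> (int n)" by simp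
  then have "(\<lambda>N. \<Sum>i<N. z i * cross (int n + int i)) \<longlonglongrightarrow> \<rho> (int n)" by (rule LIMSEQ_imp_Suc)
  then have "(\<lambda>i. z i * cross (int n + int i)) sums \<rho> (int n)" by (simp add: sums_def)
  then have "(\<lambda>i. z i * cross (int n + int i) / innov_square) sums (\<rho> (int n) / innov_square)"
    by (rule sums_divide)
  moreover have "z i * cross (int n + int i) / innov_square = z i * z (n + i)" for i
    using cross_eq[of "n + i"] innov_square_pos by (simp add: z_def)
  ultimately show ?thesis by (simp add: z_def \<rho>_def)
qed

end

section \<open>Asymptotics of the autocovariance function\<close>

theorem theorem6:
  fixes M :: "'w measure" and \<xi> X :: "int \<Rightarrow> 'w \<Rightarrow> real"
    and a r lam1 \<sigma> :: real and b :: "nat \<Rightarrow> real" and \<nu> :: "int \<Rightarrow> 'w \<Rightarrow> real"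
    and \<rho> :: "int \<Rightarrow> real"
  defines "lam1 \<equiv> prob_space.expectation M (\<xi> 0)"
    and "\<sigma> \<equiv> sqrt (prob_space.variance M (\<xi> 0))"
    and "\<nu> \<equiv> (\<lambda>k \<omega>. X k \<omega> - lam1 * volatility a b X k \<omega>)"
    and "\<rho> \<equiv> autocovariance M X"
  assumes "prob_space M"
    and "iid M \<xi>" and "\<And>k. AE \<omega> in M. \<xi> k \<omega> \<ge> 0"
    and "integrable M (\<xi> 0)" and "lam1 > 0"
    and "integrable M (\<lambda>\<omega>. (\<xi> 0 \<omega>)\<^sup>2)" and "\<sigma> > 0"
    and "a > 0"
    and "\<And>j. j \<ge> 1 \<Longrightarrow> b j \<ge> 0" and "\<exists>j\<ge>1. b j \<noteq> 0"
    and "arch_solution M \<xi> a b X" and "weakly_stationary M X"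
    and "0 < r" and "r < 1"
    and "arch_Omega lam1 \<sigma> b < 1"
    and "summable (\<lambda>j. b (Suc j) / r ^ Suc j)"
    and "lam1 * (\<Sum>j. b (Suc j) / r ^ Suc j) < 1"
    and "b \<in> weight_class1 r"
  shows "(\<lambda>n. \<rho> (int n)) \<in> weight_class r \<and>
    (\<lambda>n. \<rho> (int n) / b n) \<longlonglongrightarrow>
      prob_space.expectation M (\<lambda>\<omega>. (\<nu> 0 \<omega>)\<^sup>2) / (1 - lam1 * (\<Sum>j. b (Suc j) * r ^ Suc j))
      * (lam1 / (1 - lam1 * (\<Sum>j. b (Suc j) / r ^ Suc j))\<^sup>2)"
proof -
  interpret prob_space M by fact
  interpret iid_noise M \<xi>
    using \<open>iid M \<xi>\<close> \<open>integrable M (\<lambda>\<omega>. (\<xi> 0 \<omega>)\<^sup>2)\<close>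
    by unfold_locales (auto simp: iid_def)
  have lam: "lam = lam1" by (simp add: lam_def lam1_def)
  have var: "var = \<sigma>\<^sup>2" "var > 0"
    using \<open>\<sigma> > 0\<close> by (simp_all add: var_def \<sigma>_def)
  note b_pos = weight_class1_pos[OF \<open>b \<in> weight_class1 r\<close>]
  have b_nonneg: "b j \<ge> 0" if "j \<ge> 1" for j using b_pos[OF that] by simp
  have r_pow: "r ^ n \<le> 1" "1 \<le> 1 / r ^ n" for n
    using \<open>0 < r\<close> \<open>r < 1\<close> by (simp_all add: power_le_one)
  note scale = subcritical_mono[of b lam1 r, OF b_nonneg less_imp_le[OF \<open>lam1 > 0\<close>]
      \<open>summable (\<lambda>j. b (Suc j) / r ^ Suc j)\<close> \<open>lam1 * (\<Sum>j. b (Suc j) / r ^ Suc j) < 1\<close>]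
  \<comment> \<open>Squaring the bound on the square root needs a non-negative sum; for a negative one the claim is
    trivial.\<close>
  have Omega: "\<sigma>\<^sup>2 * (\<Sum>j. (arch_z lam1 b (Suc j))\<^sup>2) < lam1\<^sup>2"
  proof (cases "(\<Sum>j. (arch_z lam1 b (Suc j))\<^sup>2) \<ge> 0")
    case True
    have "\<sigma> * sqrt (\<Sum>j. (arch_z lam1 b (Suc j))\<^sup>2) < lam1"
      using \<open>arch_Omega lam1 \<sigma> b < 1\<close> \<open>lam1 > 0\<close> unfolding arch_Omega_def by (simp add: field_simps del: arch_z.simps)
    then have "(\<sigma> * sqrt (\<Sum>j. (arch_z lam1 b (Suc j))\<^sup>2))\<^sup>2 < lam1\<^sup>2"
      using \<open>\<sigma> > 0\<close> True by (intro power_strict_mono mult_nonneg_nonneg real_sqrt_ge_zero) auto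
    then show ?thesis using True by (simp add: power_mult_distrib del: arch_z.simps)
  next
    case False
    then have "\<sigma>\<^sup>2 * (\<Sum>j. (arch_z lam1 b (Suc j))\<^sup>2) < 0"
      using \<open>\<sigma> > 0\<close> by (intro mult_pos_neg) auto
    also have "0 < lam1\<^sup>2" using \<open>lam1 > 0\<close> by simp
    finally show ?thesis .
  qed
  interpret arch_process M \<xi> a b X
  proof unfold_locales
    show "summable (\<lambda>j. b (Suc j))" and "lam * (\<Sum>j. b (Suc j)) < 1"
      using scale[of 1] r_pow by (simp_all add: lam)
    show "summable (\<lambda>n. \<Sum>j. b (Suc n + j))"
      using b_nonneg \<open>0 < r\<close> \<open>r < 1\<close> \<open>summable (\<lambda>j. b (Suc j) / r ^ Suc j)\<close>
      by (rule geometric_tails_summable)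
    show "var * (\<Sum>j. (arch_z lam b (Suc j))\<^sup>2) < lam\<^sup>2"
      using Omega by (simp only: lam var)
  qed (use assms b_nonneg lam var in auto)
  have "\<nu> 0 = innov 0" by (simp add: \<nu>_def innov_def fun_eq_iff lam)
  define A where "A = lam1 / (1 - lam1 * (\<Sum>j. b (Suc j) / r ^ Suc j))\<^sup>2"
  define L where "L = innov_square * (A / (1 - lam1 * (\<Sum>j. b (Suc j) * r ^ Suc j)))"
  have r_less1: "lam1 * (\<Sum>j. b (Suc j) * r ^ Suc j) < 1"
  proof (rule scale(2))
    show "r ^ n \<le> 1 / r ^ n" for n using r_pow[of n] by linarith
    show "r \<ge> 0" using \<open>0 < r\<close> by simp
  qed
  have "L > 0"
    unfolding L_def A_def using innov_square_pos \<open>lam1 > 0\<close> r_less1 \<open>lam1 * (\<Sum>j. b (Suc j) / r ^ Suc j) < 1\<close>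
    by (intro mult_pos_pos divide_pos_pos) auto
  have rho: "\<rho> (int n) = innov_square * (\<Sum>i. arch_z lam1 b i * arch_z lam1 b (n + i))" for n
    using sums_unique[OF autocovariance_sums[of n]] innov_square_pos
    by (simp add: lam \<rho>_def divide_eq_eq mult.commute)
  have lim: "(\<lambda>n. \<rho> (int n) / b n) \<longlonglongrightarrow> L"
    using tendsto_mult_left[OF arch_z_autocorrelation_asymp[of lam1 b r], of innov_square] assms
    unfolding rho L_def A_def by simp
  have rho_pos: "\<rho> (int n) > 0" for n
  proof -
    have z: "arch_z lam1 b j > 0" for j using \<open>lam1 > 0\<close> b_pos by (rule arch_z_pos)
    have "0 < (\<Sum>i. arch_z lam1 b i * arch_z lam1 b (n + i))"
      using sums_summable[OF autocovariance_sums[of n]] z by (intro suminf_pos) (auto simp: lam)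
    then show ?thesis unfolding rho using innov_square_pos by simp
  qed
  have "(\<lambda>n. \<rho> (int n)) \<in> weight_class r"
  proof (rule weight_class_asymp[OF _ rho_pos _ \<open>L > 0\<close> \<open>0 < r\<close>])
    show "b(0 := 1) \<in> weight_class r"
      using \<open>b \<in> weight_class1 r\<close> by (simp add: weight_class1_def)
    have "\<forall>\<^sub>F n in sequentially. \<rho> (int n) / b n = \<rho> (int n) / (b(0 := 1)) n"
      using eventually_gt_at_top[of 0] by eventually_elim simp
    with lim show "(\<lambda>n. \<rho> (int n) / (b(0 := 1)) n) \<longlonglongrightarrow> L"
      by (rule Lim_transform_eventually)
  qed
  moreover have "L = expectation (\<lambda>\<omega>. (\<nu> 0 \<omega>)\<^sup>2) / (1 - lam1 * (\<Sum>j. b (Suc j) * r ^ Suc j))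
      * (lam1 / (1 - lam1 * (\<Sum>j. b (Suc j) / r ^ Suc j))\<^sup>2)"
    by (simp add: L_def A_def \<open>\<nu> 0 = innov 0\<close>)
  ultimately show ?thesis using lim by simp
qed

end
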